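(* Let $f,d\in V^*_+$, let $u\in\mathbf Q(f)$ with $0\le u\le\bar u$ a.e., and let $\Phi\colon V\to V$ be Hadamard directionally differentiable. Let $(\alpha_n)_{n\ge1}$ and $(\delta_n)_{n\ge1}$ be the sequences in $V$ defined in the context. Suppose that either (i) $Au,f\in H$ and $(Au-f)(u-\Phi(u))=0$ a.e. in $X$, and for all $n$, $\Phi'(u)(\alpha_n)\ge0$ q.e. on $\mathcal A(u)$ and $\Phi'(u)(\alpha_n)=0$ a.e. in $\mathcal A(u)$; or (ii) there exists $c>0$ such that $\|\Phi'(u)(b)\|_V\le\frac{C_a-c}{C_b}\|b\|_V$ for all $b\in V$. Then $\{\alpha_n\}_{n\in\mathbb N}$ and $\{\delta_n\}_{n\in\mathbb N}$ are bounded in $V$.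
   Context: Setting: $X$ is a locally compact topological space that is countable at infinity, $\xi$ is a Radon measure on $X$, $H:=L^2(X;\xi)$ (real-valued), and $V$ is a real Hilbert space with $V\subset H$ continuously and densely such that $|u|\in V$ and $\|u^+\|_V\le\kappa\|u\|_V$ for all $u\in V$, for some constant $\kappa>0$ (convention $u=u^+-u^-$). $V\cap C_c(X)$ is dense in $C_c(X)$ in the supremum norm and dense in $V$ in the $V$-norm. $A\colon V\to V^*$ is linear and, for all $u,v\in V$, $\langle Au,v\rangle\le C_b\|u\|_V\|v\|_V$, $\langle Au,u\rangle\ge C_a\|u\|_V^2$ with $C_a>0$, and $\langle Au^+,u^-\rangle\le0$. The map $\Phi\colon H\to V$ (possibly nonlinear) satisfies $\Phi(0)\ge0$ a.e. and is increasing: $u\ge v$ a.e. implies $\Phi(u)\ge\Phi(v)$ a.e. Notation: $V_+:=\{v\in V:v\ge0\text{ a.e.}\}$, $V^*_+:=\{g\in V^*:\langle g,v\rangle\ge0\ \forall v\in V_+\}$. $\mathbf K(\varphi):=\{v\in V:v\le\Phi(\varphi)\text{ a.e.}\}$. $\mathbf Q(f)$ is the set of all $u\in V$ with $u\in\mathbf K(u)$ and $\langle Au-f,u-v\rangle\le0$ for all $v\in\mathbf K(u)$. $\bar u\in V$ solves $A\bar u=f$. Elements of $V$ are represented by quasi-continuous representatives; q.e. means outside a set of capacity zero, for the usual capacity associated with $V$: $\mathrm{cap}(E)=\inf\{\|v\|_V^2: v\in V,\ v\ge1\text{ a.e. on an open neighbourhood of }E\}$. $\mathcal A(u):=\{x\in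 X:u(x)=\Phi(u)(x)\}$. Hadamard directional differentiability of $\Phi\colon V\to V$: for all $v,h\in V$ the limit $\Phi'(v)(h):=\lim_{h'\to h,\,t\to0^+}(\Phi(v+th')-\Phi(v))/t$ exists in $V$. For $g\in V^*$, $z=S_0(g)\in V$ denotes the unique solution of: $z\ge0$ a.e., $\langle Az-g,z-v\rangle\le0$ for all $v\in V$ with $v\ge0$ a.e. By Mignot's theorem the directional derivative $S_0'(g)(d):=\lim_{t\to0^+}(S_0(g+td)-S_0(g))/t$ exists in $V$ for all $g,d\in V^*$. Put $\partial S(f,u)(e):=-S_0'(A\Phi(u)-f)(-e)$ for $e\in V^*$ (the directional derivative, with respect to the source term, of the solution map of the variational inequality with obstacle $\Phi(u)$). Define $\alpha_1:=\delta_1:=\partial S(f,u)(d)$ and, for $n\ge2$, $\delta_n:=\partial S(f,u)(d-A\Phi'(u)(\alpha_{n-1}))$ and $\alpha_n:=\Phi'(u)(\alpha_{n-1})+\delta_n$. *)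

theory Defs
  imports "HOL-Analysis.Analysis"
begin

section \<open>The function spaces\<close>

text \<open>
  Radon measure: a Borel measure that is finite on compact sets and inner regular.
  Only \<sigma>-compact locally compact Hausdorff spaces are considered, where outer regularity
  is automatic.
\<close>

definition radon_measure :: "'a::topological_space measure \<Rightarrow> bool" where
  "radon_measure \<xi> \<longleftrightarrow>
     sets \<xi> = sets borel \<and>
     (\<forall>K. compact K \<longrightarrow> emeasure \<xi> K < \<infinity>) \<and>
     (\<forall>B \<in> sets borel. emeasure \<xi> B = (SUP K \<in> {K. compact K \<and> K \<subseteq> B}. emeasure \<xi> K))"

text \<open>
  Elements of $H = L^2(X;\xi)$ are represented by square-integrable Borel functions; equality
  in $H$ is equality almost everywhere.
\<close>

definition L2 :: "'a measure \<Rightarrow> ('a \<Rightarrow> real) set" where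
  "L2 \<xi> = {h \<in> borel_measurable \<xi>. integrable \<xi> (\<lambda>x. (h x)\<^sup>2)}"

definition L2_norm :: "'a measure \<Rightarrow> ('a \<Rightarrow> real) \<Rightarrow> real" where
  "L2_norm \<xi> h = sqrt (\<integral>x. (h x)\<^sup>2 \<partial>\<xi>)"

definition C_c :: "('a::topological_space \<Rightarrow> real) set" where
  "C_c = {\<phi>. continuous_on UNIV \<phi> \<and> compact (closure {x. \<phi> x \<noteq> 0})}"

text \<open>
  The Hilbert space $V \subset H$ is an abstract complete inner product space \<open>'v\<close> together with
  the inclusion \<open>\<iota>\<close>, which sends \<open>v\<close> to some representative of its class in $H$.
  Two elements have the same image in $H$ iff their representatives agree almost everywhere.
\<close>

definition pos_part :: "'a measure \<Rightarrow> ('v \<Rightarrow> 'a \<Rightarrow> real) \<Rightarrow> 'v \<Rightarrow> 'v" where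
  "pos_part \<xi> \<iota> u = (THE w. AE x in \<xi>. \<iota> w x = max (\<iota> u x) 0)"

definition neg_part :: "'a measure \<Rightarrow> ('v \<Rightarrow> 'a \<Rightarrow> real) \<Rightarrow> 'v \<Rightarrow> 'v" where
  "neg_part \<xi> \<iota> u = (THE w. AE x in \<xi>. \<iota> w x = max (- \<iota> u x) 0)"

locale form_domain =
  fixes \<xi> :: "'a::t2_space measure"
    and \<iota> :: "'v::{real_inner, complete_space} \<Rightarrow> 'a \<Rightarrow> real"
    and \<kappa> :: real
  assumes locally_compact: "locally_compact_space (euclidean :: 'a topology)"
    and countable_at_infinity:
      "\<exists>K :: nat \<Rightarrow> 'a set. (\<forall>n. compact (K n)) \<and> (\<Union>n. K n) = UNIV"
    and radon: "radon_measure \<xi>"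
    and incl_L2: "\<iota> v \<in> L2 \<xi>"
    and incl_add: "AE x in \<xi>. \<iota> (v + w) x = \<iota> v x + \<iota> w x"
    and incl_scaleR: "AE x in \<xi>. \<iota> (r *\<^sub>R v) x = r * \<iota> v x"
    and incl_inj: "(AE x in \<xi>. \<iota> v x = 0) \<Longrightarrow> v = 0"
    and incl_continuous: "\<exists>C. \<forall>v. L2_norm \<xi> (\<iota> v) \<le> C * norm v"
    and incl_dense: "h \<in> L2 \<xi> \<Longrightarrow> \<epsilon> > 0 \<Longrightarrow> \<exists>v. L2_norm \<xi> (\<lambda>x. h x - \<iota> v x) < \<epsilon>"
    and abs_in_V: "\<exists>w. AE x in \<xi>. \<iota> w x = \<bar>\<iota> u x\<bar>"
    and kappa_pos: "\<kappa> > 0"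
    and norm_pos_part_le: "norm (pos_part \<xi> \<iota> u) \<le> \<kappa> * norm u"
    and dense_C_c: "\<psi> \<in> C_c \<Longrightarrow> \<epsilon> > 0 \<Longrightarrow>
      \<exists>v. \<exists>\<phi> \<in> C_c. (AE x in \<xi>. \<iota> v x = \<phi> x) \<and> (\<forall>x. \<bar>\<psi> x - \<phi> x\<bar> < \<epsilon>)"
    and dense_V: "\<epsilon> > 0 \<Longrightarrow>
      \<exists>w. \<exists>\<phi> \<in> C_c. (AE x in \<xi>. \<iota> w x = \<phi> x) \<and> norm (v - w) < \<epsilon>"

section \<open>Capacity\<close>

definition cap :: "'a::topological_space measure \<Rightarrow> ('v::real_normed_vector \<Rightarrow> 'a \<Rightarrow> real) \<Rightarrow> 'a set \<Rightarrow> ennreal" where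
  "cap \<xi> \<iota> E =
     (INF v \<in> {v. \<exists>U. open U \<and> E \<subseteq> U \<and> (AE x in \<xi>. x \<in> U \<longrightarrow> \<iota> v x \<ge> 1)}. ennreal ((norm v)\<^sup>2))"

definition quasi_everywhere ::
    "'a::topological_space measure \<Rightarrow> ('v::real_normed_vector \<Rightarrow> 'a \<Rightarrow> real) \<Rightarrow> ('a \<Rightarrow> bool) \<Rightarrow> bool" where
  "quasi_everywhere \<xi> \<iota> P \<longleftrightarrow> (\<exists>N. cap \<xi> \<iota> N = 0 \<and> (\<forall>x. x \<notin> N \<longrightarrow> P x))"

definition quasi_continuous ::
    "'a::topological_space measure \<Rightarrow> ('v::real_normed_vector \<Rightarrow> 'a \<Rightarrow> real) \<Rightarrow> ('a \<Rightarrow> real) \<Rightarrow> bool" where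
  "quasi_continuous \<xi> \<iota> w \<longleftrightarrow>
     (\<forall>\<epsilon>>0. \<exists>U. open U \<and> cap \<xi> \<iota> U < ennreal \<epsilon> \<and> continuous_on (- U) w)"

text \<open>
  In a \<open>form_domain\<close> every element of $V$ has a quasi-continuous representative, unique up to a
  set of capacity zero, so the choice below is immaterial.
\<close>

definition qc_rep :: "'a::topological_space measure \<Rightarrow> ('v::real_normed_vector \<Rightarrow> 'a \<Rightarrow> real) \<Rightarrow> 'v \<Rightarrow> 'a \<Rightarrow> real" where
  "qc_rep \<xi> \<iota> v = (SOME w. quasi_continuous \<xi> \<iota> w \<and> (AE x in \<xi>. w x = \<iota> v x))"

section \<open>The quasi-variational inequality\<close>

text \<open>The dual $V^*$ is \<open>'v \<Rightarrow>\<^sub>L real\<close>, with duality pairing \<open>blinfun_apply\<close>.\<close>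

locale qvi_setting = form_domain \<xi> \<iota> \<kappa>
  for \<xi> :: "'a::t2_space measure"
    and \<iota> :: "'v::{real_inner, complete_space} \<Rightarrow> 'a \<Rightarrow> real"
    and \<kappa> :: real +
  fixes A :: "'v \<Rightarrow> ('v \<Rightarrow>\<^sub>L real)"
    and C\<^sub>a C\<^sub>b :: real
    and \<Phi> :: "('a \<Rightarrow> real) \<Rightarrow> 'v"
  assumes A_linear: "linear A"
    and A_bounded: "blinfun_apply (A u) v \<le> C\<^sub>b * norm u * norm v"
    and C\<^sub>a_pos: "C\<^sub>a > 0"
    and A_coercive: "blinfun_apply (A u) u \<ge> C\<^sub>a * (norm u)\<^sup>2"
    and A_T_monotone: "blinfun_apply (A (pos_part \<xi> \<iota> u)) (neg_part \<xi> \<iota> u) \<le> 0"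
    and \<Phi>_well_defined: "h \<in> L2 \<xi> \<Longrightarrow> k \<in> L2 \<xi> \<Longrightarrow> (AE x in \<xi>. h x = k x) \<Longrightarrow> \<Phi> h = \<Phi> k"
    and \<Phi>_zero: "AE x in \<xi>. \<iota> (\<Phi> (\<lambda>_. 0)) x \<ge> 0"
    and \<Phi>_increasing: "h \<in> L2 \<xi> \<Longrightarrow> k \<in> L2 \<xi> \<Longrightarrow> (AE x in \<xi>. h x \<ge> k x) \<Longrightarrow>
      (AE x in \<xi>. \<iota> (\<Phi> h) x \<ge> \<iota> (\<Phi> k) x)"

definition V_plus :: "'a measure \<Rightarrow> ('v \<Rightarrow> 'a \<Rightarrow> real) \<Rightarrow> 'v set" where
  "V_plus \<xi> \<iota> = {v. AE x in \<xi>. \<iota> v x \<ge> 0}"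

definition Vstar_plus :: "'a measure \<Rightarrow> ('v::real_normed_vector \<Rightarrow> 'a \<Rightarrow> real) \<Rightarrow> ('v \<Rightarrow>\<^sub>L real) set" where
  "Vstar_plus \<xi> \<iota> = {g. \<forall>v \<in> V_plus \<xi> \<iota>. blinfun_apply g v \<ge> 0}"

definition K_set :: "'a measure \<Rightarrow> ('v \<Rightarrow> 'a \<Rightarrow> real) \<Rightarrow> (('a \<Rightarrow> real) \<Rightarrow> 'v) \<Rightarrow> ('a \<Rightarrow> real) \<Rightarrow> 'v set" where
  "K_set \<xi> \<iota> \<Phi> \<phi> = {v. AE x in \<xi>. \<iota> v x \<le> \<iota> (\<Phi> \<phi>) x}"

definition Q_set :: "'a measure \<Rightarrow> ('v::real_normed_vector \<Rightarrow> 'a \<Rightarrow> real) \<Rightarrow> ('v \<Rightarrow> ('v \<Rightarrow>\<^sub>L real)) \<Rightarrow>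
    (('a \<Rightarrow> real) \<Rightarrow> 'v) \<Rightarrow> ('v \<Rightarrow>\<^sub>L real) \<Rightarrow> 'v set" where
  "Q_set \<xi> \<iota> A \<Phi> f = {u. u \<in> K_set \<xi> \<iota> \<Phi> (\<iota> u) \<and>
     (\<forall>v \<in> K_set \<xi> \<iota> \<Phi> (\<iota> u). blinfun_apply (A u - f) (u - v) \<le> 0)}"

definition coincidence_set :: "'a::topological_space measure \<Rightarrow> ('v::real_normed_vector \<Rightarrow> 'a \<Rightarrow> real) \<Rightarrow>
    (('a \<Rightarrow> real) \<Rightarrow> 'v) \<Rightarrow> 'v \<Rightarrow> 'a set" where
  "coincidence_set \<xi> \<iota> \<Phi> u = {x. qc_rep \<xi> \<iota> u x = qc_rep \<xi> \<iota> (\<Phi> (\<iota> u)) x}"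

text \<open>
  A functional $g \in V^*$ lies in $H$, embedded into $V^*$ via the inner product of $H$, and
  is given there by the function \<open>k\<close>.
\<close>

definition represents :: "'a measure \<Rightarrow> ('v::real_normed_vector \<Rightarrow> 'a \<Rightarrow> real) \<Rightarrow> ('a \<Rightarrow> real) \<Rightarrow> ('v \<Rightarrow>\<^sub>L real) \<Rightarrow> bool" where
  "represents \<xi> \<iota> k g \<longleftrightarrow> k \<in> L2 \<xi> \<and> (\<forall>v. blinfun_apply g v = (\<integral>x. k x * \<iota> v x \<partial>\<xi>))"

section \<open>Directional derivatives\<close>

definition hadamard_differentiable :: "('v::real_normed_vector \<Rightarrow> 'v) \<Rightarrow> bool" where
  "hadamard_differentiable F \<longleftrightarrow>
     (\<forall>v h. \<exists>l. ((\<lambda>(h', t). (F (v + t *\<^sub>R h') - F v) /\<^sub>R t) \<longlongrightarrow> l) (nhds h \<times>\<^sub>F at_right 0))"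

definition hadamard_derivative :: "('v::real_normed_vector \<Rightarrow> 'v) \<Rightarrow> 'v \<Rightarrow> 'v \<Rightarrow> 'v" where
  "hadamard_derivative F v h =
     Lim (nhds h \<times>\<^sub>F at_right 0) (\<lambda>(h', t). (F (v + t *\<^sub>R h') - F v) /\<^sub>R t)"

definition S0 :: "'a measure \<Rightarrow> ('v::real_normed_vector \<Rightarrow> 'a \<Rightarrow> real) \<Rightarrow> ('v \<Rightarrow> ('v \<Rightarrow>\<^sub>L real)) \<Rightarrow> ('v \<Rightarrow>\<^sub>L real) \<Rightarrow> 'v" where
  "S0 \<xi> \<iota> A g = (THE z. z \<in> V_plus \<xi> \<iota> \<and> (\<forall>v \<in> V_plus \<xi> \<iota>. blinfun_apply (A z - g) (z - v) \<le> 0))"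

text \<open>The limit exists for all \<open>g\<close> and \<open>d\<close> in a \<open>qvi_setting\<close>, by a theorem of Mignot.\<close>

definition S0' :: "'a measure \<Rightarrow> ('v::real_normed_vector \<Rightarrow> 'a \<Rightarrow> real) \<Rightarrow> ('v \<Rightarrow> ('v \<Rightarrow>\<^sub>L real)) \<Rightarrow>
    ('v \<Rightarrow>\<^sub>L real) \<Rightarrow> ('v \<Rightarrow>\<^sub>L real) \<Rightarrow> 'v" where
  "S0' \<xi> \<iota> A g d = Lim (at_right 0) (\<lambda>t::real. (S0 \<xi> \<iota> A (g + t *\<^sub>R d) - S0 \<xi> \<iota> A g) /\<^sub>R t)"

definition dS :: "'a measure \<Rightarrow> ('v::real_normed_vector \<Rightarrow> 'a \<Rightarrow> real) \<Rightarrow> ('v \<Rightarrow> ('v \<Rightarrow>\<^sub>L real)) \<Rightarrow>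
    (('a \<Rightarrow> real) \<Rightarrow> 'v) \<Rightarrow> ('v \<Rightarrow>\<^sub>L real) \<Rightarrow> 'v \<Rightarrow> ('v \<Rightarrow>\<^sub>L real) \<Rightarrow> 'v" where
  "dS \<xi> \<iota> A \<Phi> f u e = - S0' \<xi> \<iota> A (A (\<Phi> (\<iota> u)) - f) (- e)"

text \<open>The derivative of \<open>\<Phi>\<close> considered as a map $V \to V$.\<close>

definition D\<Phi> :: "('v::real_normed_vector \<Rightarrow> 'a \<Rightarrow> real) \<Rightarrow> (('a \<Rightarrow> real) \<Rightarrow> 'v) \<Rightarrow> 'v \<Rightarrow> 'v \<Rightarrow> 'v" where
  "D\<Phi> \<iota> \<Phi> u h = hadamard_derivative (\<lambda>v. \<Phi> (\<iota> v)) u h"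

end

theory Submission
  imports Defs
begin

text \<open>
  Everything rests on the variational inequality that Mignot's theorem gives for
  $\delta = \partial S(f,u)(e)$, namely $\langle A\delta - e, \delta + v\rangle \le 0$ for all
  $v$ in the critical cone of the positive cone at $\Phi(u) - u$. With $e = d - A\Phi'(u)(\alpha_{n-1})$
  it reads $\langle A\alpha_n - d, \alpha_n - \Phi'(u)(\alpha_{n-1}) + v\rangle \le 0$. In case (i),
  $v = \Phi'(u)(\alpha_{n-1})$ is admissible and coercivity bounds $\alpha_n$ by $\|d\| / C_a$;
  in case (ii), $v = 0$ gives a contraction estimate.

  The positive cone is polyhedric because lattice operations are bounded in $V$ and continuous in
  $L^2$, hence weakly continuous in $V$. That $v$ lies in the tangent cone at $z$ as soon as $v \ge 0$
  quasi-everywhere on $\{z = 0\}$ is shown without representing positive functionals by measures: if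
  $h \ge 0$ is a functional with $h(z) = 0$ and $p = v^-$, a Dini argument outside a set of small
  capacity bounds $p$ by $nz + \eta\psi + My$ with $\eta$ and $\|y\|$ small.
\<close>

section \<open>Closed convex sets in Hilbert spaces\<close>

text \<open>The lattice operations of V are only known to be bounded, through
  \<open>norm_pos_part_le\<close>; continuity of the positive part in the V-norm is not given.
  Truncated sequences are therefore followed in L^2, and what survives in V is a weak limit. Such
  limits enter only through closed convex sets, so every passage to the limit is phrased as
  membership in the closure of a convex set. As A need not be symmetric, the variational
  inequalities are solved by a fixed point and not by minimising an energy. The positive cone
  appears through z = \<Phi>(u) - u: this is the value of \<open>S0\<close> at A\<Phi>(u) - f, and
  its residual f - Au is a positive functional that vanishes at z. In case (i) the q.e. sign
  condition puts \<Phi>'(u)(\<alpha>_n) into the tangent cone at z, and the a.e. condition puts it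
  into the kernel of f - Au; polyhedricity combines the two. Case (i) contains no norm estimate for
  \<Phi>'(u), so the bound on \<delta>_n = \<alpha>_n - \<Phi>'(u)(\<alpha>_{n-1}) relies on the
  linear growth that Hadamard differentiability itself provides.\<close>

lemma closest_point_exists:
  fixes K :: "'v::{real_inner, complete_space} set"
  assumes "convex K" "closed K" "K \<noteq> {}"
  shows "\<exists>p\<in>K. \<forall>v\<in>K. (x - p) \<bullet> (v - p) \<le> 0"
proof -
  define D where "D = Inf ((\<lambda>v. (norm (x - v))\<^sup>2) ` K)"
  have bdd: "bdd_below ((\<lambda>v. (norm (x - v))\<^sup>2) ` K)"
    by (rule bdd_belowI[of _ 0]) auto
  have D_le: "D \<le> (norm (x - v))\<^sup>2" if "v \<in> K" for v
    unfolding D_def using bdd that by (auto intro: cInf_lower)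
  have "\<exists>v\<in>K. (norm (x - v))\<^sup>2 < D + inverse (real (Suc n))" for n
  proof -
    have "D < D + inverse (real (Suc n))" by simp
    with assms(3) show ?thesis using cInf_lessD[of "(\<lambda>v. (norm (x - v))\<^sup>2) ` K" "D + inverse (real (Suc n))"]
      unfolding D_def by auto
  qed
  then obtain s where sK: "s n \<in> K" and s: "(norm (x - s n))\<^sup>2 < D + inverse (real (Suc n))" for n
    by metis
  \<comment> \<open>Parallelogram law: the midpoint of two almost minimisers lies in
    \<open>K\<close>, so its squared distance to \<open>x\<close> is at least \<open>D\<close>,
    which forces the two points together.\<close>
  have par: "(norm (s m - s n))\<^sup>2 \<le> 2 * inverse (real (Suc m)) + 2 * inverse (real (Suc n))" for m n
  proof -
    have "(1/2) *\<^sub>R s m + (1/2) *\<^sub>R s n \<in> K"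
      using assms(1) sK by (intro convexD) auto
    then have "D \<le> (norm (x - ((1/2) *\<^sub>R s m + (1/2) *\<^sub>R s n)))\<^sup>2" by (rule D_le)
    moreover have "(norm (s m - s n))\<^sup>2 = 2 * (norm (x - s m))\<^sup>2 + 2 * (norm (x - s n))\<^sup>2
        - 4 * (norm (x - ((1/2) *\<^sub>R s m + (1/2) *\<^sub>R s n)))\<^sup>2"
      unfolding power2_norm_eq_inner by (simp add: inner_diff inner_add inner_commute algebra_simps)
    ultimately show ?thesis using s[of m] s[of n] by simp
  qed
  have "Cauchy s"
  proof (rule metric_CauchyI)
    fix e :: real assume "e > 0"
    then obtain M where M: "inverse (real (Suc M)) < e\<^sup>2 / 4"
      using reals_Archimedean[of "e\<^sup>2/4"] by auto
    have "dist (s m) (s n) < e" if "m \<ge> M" "n \<ge> M" for m n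
    proof -
      have "inverse (real (Suc m)) \<le> inverse (real (Suc M))" "inverse (real (Suc n)) \<le> inverse (real (Suc M))"
        using that by (simp_all add: field_simps)
      then have "(norm (s m - s n))\<^sup>2 < e\<^sup>2" using par[of m n] M by linarith
      then show ?thesis using \<open>e > 0\<close> by (simp add: dist_norm power2_less_imp_less)
    qed
    then show "\<exists>M. \<forall>m\<ge>M. \<forall>n\<ge>M. dist (s m) (s n) < e" by blast
  qed
  then obtain p where p: "s \<longlonglongrightarrow> p" using Cauchy_convergent convergent_def by blast
  have pK: "p \<in> K" using assms(2) sK p closed_sequentially by blast
  have "(\<lambda>n. (norm (x - s n))\<^sup>2) \<longlonglongrightarrow> (norm (x - p))\<^sup>2" by (intro tendsto_intros p)
  moreover have "(\<lambda>n. D + inverse (real (Suc n))) \<longlonglongrightarrow> D + 0"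
    by (intro tendsto_intros LIMSEQ_inverse_real_of_nat)
  ultimately have pD: "(norm (x - p))\<^sup>2 \<le> D"
    using s by (intro LIMSEQ_le) (auto intro: less_imp_le)
  have "dist x p \<le> dist x z" if "z \<in> K" for z
  proof -
    have "(norm (x - p))\<^sup>2 \<le> (norm (x - z))\<^sup>2"
      using pD D_le[OF that] by linarith
    then show ?thesis unfolding dist_norm by (rule power2_le_imp_le) simp
  qed
  then have obtuse: "(x - p) \<bullet> (v - p) \<le> 0" if "v \<in> K" for v
    using any_closest_point_dot[OF assms(1,2) pK that] by simp
  with pK show ?thesis by blast
qed

text \<open>The point \<open>p\<close> of least norm on the hyperplane h = 1 is orthogonal to the
  kernel of h, and v - h(v) p always lies in that kernel. The representing vector is
  \<open>p\<close> divided by its squared norm.\<close>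

lemma riesz_representation:
  fixes h :: "'v::{real_inner, complete_space} \<Rightarrow>\<^sub>L real"
  shows "\<exists>r. \<forall>v. blinfun_apply h v = r \<bullet> v"
proof (cases "h = 0")
  case True
  then show ?thesis by (intro exI[of _ 0]) simp
next
  case False
  then obtain v0 where "blinfun_apply h v0 \<noteq> 0" by (metis blinfun_eqI blinfun.zero_left)
  define S where "S = {v. blinfun_apply h v = 1}"
  have "v0 /\<^sub>R blinfun_apply h v0 \<in> S"
    using \<open>blinfun_apply h v0 \<noteq> 0\<close> by (simp add: S_def blinfun.scaleR_right)
  moreover have "convex S"
    by (auto simp: S_def convex_def blinfun.add_right blinfun.scaleR_right)
  moreover have "closed S"
    unfolding S_def by (intro closed_Collect_eq continuous_intros)
  ultimately obtain p where p: "p \<in> S" and "\<forall>v\<in>S. (0 - p) \<bullet> (v - p) \<le> 0"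
    using closest_point_exists[of S 0] by auto
  then have ge: "p \<bullet> (v - p) \<ge> 0" if "v \<in> S" for v using that by auto
  have orth: "p \<bullet> w = 0" if "blinfun_apply h w = 0" for w
  proof -
    have "p + w \<in> S" "p - w \<in> S"
      using p that by (auto simp: S_def blinfun.add_right blinfun.diff_right)
    then show ?thesis using ge[of "p + w"] ge[of "p - w"] by (simp add: inner_diff)
  qed
  have "p \<bullet> p \<noteq> 0" using p by (auto simp: S_def blinfun.zero_right)
  have "p \<bullet> v = blinfun_apply h v * (p \<bullet> p)" for v
  proof -
    have "p \<bullet> (v - blinfun_apply h v *\<^sub>R p) = 0"
      using p by (intro orth) (simp add: S_def blinfun.diff_right blinfun.scaleR_right)
    then show ?thesis by (simp add: inner_diff)
  qed
  with \<open>p \<bullet> p \<noteq> 0\<close> have "blinfun_apply h v = (p /\<^sub>R (p \<bullet> p)) \<bullet> v" for v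
    by (metis inner_scaleR_left mult.commute nonzero_mult_div_cancel_right divide_inverse)
  then show ?thesis by blast
qed

text \<open>With the projection P onto \<open>K\<close> and the Riesz map R, the solutions are the
  fixed points of z \<mapsto> P(z - \<rho> R(Az - g)). The projection is nonexpansive, so for
  suitable \<rho> coercivity makes this map a contraction.\<close>

lemma lions_stampacchia:
  fixes A :: "'v::{real_inner, complete_space} \<Rightarrow> 'v \<Rightarrow>\<^sub>L real"
  assumes K: "convex K" "closed K" "K \<noteq> {}"
    and lin: "linear A"
    and bdd: "\<And>u v. blinfun_apply (A u) v \<le> C\<^sub>b * norm u * norm v"
    and pos: "C\<^sub>a > 0"
    and coercive: "\<And>u. blinfun_apply (A u) u \<ge> C\<^sub>a * (norm u)\<^sup>2"
  shows "\<exists>!z. z \<in> K \<and> (\<forall>v\<in>K. blinfun_apply (A z - g) (z - v) \<le> 0)"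
proof -
  note A_simps = linear_add[OF lin] linear_diff[OF lin] blinfun.diff_left blinfun.diff_right
  obtain P where P: "P x \<in> K" "\<And>v. v \<in> K \<Longrightarrow> (x - P x) \<bullet> (v - P x) \<le> 0" for x
    using closest_point_exists[OF K] by metis
  obtain R where R: "blinfun_apply h v = R h \<bullet> v" for h :: "'v \<Rightarrow>\<^sub>L real" and v
    using riesz_representation by metis
  have nonexp: "norm (P x - P y) \<le> norm (x - y)" for x y
  proof -
    have "(x - P x) \<bullet> (P y - P x) \<le> 0" "(y - P y) \<bullet> (P x - P y) \<le> 0" using P by auto
    then have "(norm (P x - P y))\<^sup>2 \<le> (x - y) \<bullet> (P x - P y)"
      unfolding power2_norm_eq_inner by (simp add: inner_diff inner_commute)
    also have "\<dots> \<le> norm (x - y) * norm (P x - P y)" by (rule norm_cauchy_schwarz)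
    finally show ?thesis by (cases "P x = P y") (auto simp: power2_eq_square)
  qed
  \<comment> \<open>Nothing relates \<open>C\<^sub>b\<close> to \<open>C\<^sub>a\<close> when V is
    trivial; the maximum guarantees 0 < \<open>C\<^sub>a\<close> \<le> \<open>M\<close>, hence 0
    \<le> \<open>q\<close> < 1 below.\<close>
  define M where "M = max C\<^sub>b C\<^sub>a"
  have M: "M > 0" "C\<^sub>a \<le> M" using pos by (auto simp: M_def)
  have bddM: "blinfun_apply (A u) v \<le> M * norm u * norm v" for u v
    using bdd[of u v] mult_right_mono[of C\<^sub>b M "norm u * norm v"] by (simp add: M_def mult.assoc)
  \<comment> \<open>This step size minimises 1 - 2 \<rho> \<open>C\<^sub>a\<close> + \<rho>^2 M^2,
    the squared contraction factor; the minimum is \<open>q\<close>.\<close>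
  define \<rho> where "\<rho> = C\<^sub>a / M\<^sup>2"
  have \<rho>: "\<rho> > 0" using pos M by (simp add: \<rho>_def)
  define q where "q = 1 - C\<^sub>a\<^sup>2 / M\<^sup>2"
  have q: "0 \<le> q" "q < 1"
    using pos M by (simp_all add: q_def field_simps)
  define T where "T z = P (z - \<rho> *\<^sub>R R (A z - g))" for z
  have contr: "dist (T x) (T y) \<le> sqrt q * dist x y" for x y
  proof -
    define w where "w = x - y"
    have RA: "R (A x - g) - R (A y - g) = R (A w)"
    proof -
      have "(R (A x - g) - R (A y - g)) \<bullet> v = R (A w) \<bullet> v" for v
        by (simp add: inner_diff R[symmetric] w_def A_simps)
      then show ?thesis by (metis vector_eq_rdot)
    qed
    have "norm (R (A w)) \<le> M * norm w"
    proof -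
      have "(norm (R (A w)))\<^sup>2 = blinfun_apply (A w) (R (A w))" by (simp add: R power2_norm_eq_inner)
      also have "\<dots> \<le> M * norm w * norm (R (A w))" by (rule bddM)
      finally show ?thesis using M by (cases "R (A w) = 0") (auto simp: power2_eq_square)
    qed
    then have n2: "(norm (R (A w)))\<^sup>2 \<le> M\<^sup>2 * (norm w)\<^sup>2"
      by (metis norm_ge_zero power_mono power_mult_distrib)
    have "(norm (T x - T y))\<^sup>2 \<le> (norm (w - \<rho> *\<^sub>R R (A w)))\<^sup>2"
    proof (rule power_mono)
      have "w - \<rho> *\<^sub>R R (A w) = (x - \<rho> *\<^sub>R R (A x - g)) - (y - \<rho> *\<^sub>R R (A y - g))"
        unfolding RA[symmetric] by (simp add: w_def scaleR_diff_right)
      then show "norm (T x - T y) \<le> norm (w - \<rho> *\<^sub>R R (A w))"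
        unfolding T_def using nonexp by metis
    qed simp
    also have "\<dots> = (norm w)\<^sup>2 - 2 * \<rho> * blinfun_apply (A w) w + \<rho>\<^sup>2 * (norm (R (A w)))\<^sup>2"
      unfolding power2_norm_eq_inner R
      by (simp add: inner_diff inner_commute power2_eq_square algebra_simps)
    also have "\<dots> \<le> (norm w)\<^sup>2 - 2 * \<rho> * (C\<^sub>a * (norm w)\<^sup>2) + \<rho>\<^sup>2 * (M\<^sup>2 * (norm w)\<^sup>2)"
      using coercive[of w] n2 \<rho> by (intro add_mono diff_mono mult_left_mono) auto
    also have "\<dots> = q * (norm w)\<^sup>2"
      using M(1) by (simp add: q_def \<rho>_def field_simps power2_eq_square)
    finally have "norm (T x - T y) \<le> sqrt (q * (norm w)\<^sup>2)"
      by (rule real_le_rsqrt)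
    then show ?thesis by (simp add: dist_norm w_def real_sqrt_mult)
  qed
  have "\<exists>!z\<in>K. T z = z"
    using q P(1) contr K complete_eq_closed
    by (intro Banach_fix[where c = "sqrt q"]) (auto simp: T_def)
  then obtain z where z: "z \<in> K" "T z = z" by blast
  have sol: "blinfun_apply (A z - g) (z - v) \<le> 0" if "v \<in> K" for v
  proof -
    have "(z - \<rho> *\<^sub>R R (A z - g) - z) \<bullet> (v - z) \<le> 0"
      using P(2)[OF that, of "z - \<rho> *\<^sub>R R (A z - g)"] z(2) by (simp add: T_def)
    then have "\<rho> * (R (A z - g) \<bullet> (z - v)) \<le> 0" by (simp add: inner_diff algebra_simps)
    then show ?thesis using \<rho> by (simp add: R mult_le_0_iff)
  qed
  show ?thesis
  proof (rule ex1I[of _ z])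
    show "z \<in> K \<and> (\<forall>v\<in>K. blinfun_apply (A z - g) (z - v) \<le> 0)" using z sol by blast
  next
    fix y assume y: "y \<in> K \<and> (\<forall>v\<in>K. blinfun_apply (A y - g) (y - v) \<le> 0)"
    then have "blinfun_apply (A y - g) (y - z) \<le> 0" "blinfun_apply (A z - g) (z - y) \<le> 0"
      using z sol by auto
    then have "blinfun_apply (A (y - z)) (y - z) \<le> 0" by (simp add: A_simps)
    with coercive[of "y - z"] have "C\<^sub>a * (norm (y - z))\<^sup>2 \<le> 0" by linarith
    then show "y = z" using pos by (simp add: mult_le_0_iff)
  qed
qed

text \<open>A substitute for weak sequential compactness of bounded sets: the point \<open>y\<close> lies in every
  closed convex set that contains a tail of the sequence.\<close>

lemma bounded_seq_convex_cluster_point: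
  fixes x :: "nat \<Rightarrow> 'v::{real_inner, complete_space}"
  assumes "bounded (range x)"
  shows "\<exists>y. \<forall>n. y \<in> closure (convex hull (x ` {n..}))"
proof -
  define K where "K n = closure (convex hull (x ` {n..}))" for n
  have K: "convex (K n)" "closed (K n)" "K n \<noteq> {}" for n
    by (auto simp: K_def convex_closure)
  have mono: "K n \<subseteq> K m" if "m \<le> n" for m n
    unfolding K_def using that by (intro closure_mono hull_mono image_mono) auto
  obtain B where B: "\<And>n. norm (x n) \<le> B" using assms by (auto simp: bounded_iff)
  have KB: "norm y \<le> B" if "y \<in> K n" for y n
  proof -
    have "K n \<subseteq> cball 0 B" unfolding K_def
      by (intro closure_minimal hull_minimal) (auto simp: B)
    then show ?thesis using that by auto
  qed
  \<comment> \<open>\<open>p n\<close> is the element of least norm of \<open>K n\<close>. As the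
    sets shrink these norms increase, and they stay below \<open>B\<close>, so they converge; the
    obtuse-angle inequality then turns convergence of the norms into the Cauchy property of
    \<open>p\<close>.\<close>
  obtain p where p: "p n \<in> K n" "\<And>v. v \<in> K n \<Longrightarrow> (0 - p n) \<bullet> (v - p n) \<le> 0" for n
  proof -
    have "\<exists>p. p \<in> K n \<and> (\<forall>v\<in>K n. (0 - p) \<bullet> (v - p) \<le> 0)" for n
      using closest_point_exists[OF K, of n 0] by auto
    with that show ?thesis by metis
  qed
  have key: "(norm (p m - p n))\<^sup>2 \<le> (norm (p m))\<^sup>2 - (norm (p n))\<^sup>2" if "n \<le> m" for m n
  proof -
    have "p m \<in> K n" using p mono[OF that] by blast
    from p(2)[OF this] show ?thesis
      unfolding power2_norm_eq_inner by (simp add: inner_diff inner_commute)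
  qed
  have "mono (\<lambda>n. (norm (p n))\<^sup>2)"
  proof (rule monoI)
    fix n m :: nat assume "n \<le> m"
    from key[OF this] show "(norm (p n))\<^sup>2 \<le> (norm (p m))\<^sup>2"
      using zero_le_power2[of "norm (p m - p n)"] by linarith
  qed
  moreover have "(norm (p n))\<^sup>2 \<le> B\<^sup>2" for n using KB[OF p(1)] by (intro power_mono) auto
  ultimately have "convergent (\<lambda>n. (norm (p n))\<^sup>2)"
    by (intro Bseq_mono_convergent BseqI'[of _ "B\<^sup>2"]) (auto simp: mono_def)
  then have C: "Cauchy (\<lambda>n. (norm (p n))\<^sup>2)" by (rule convergent_Cauchy)
  have "Cauchy p"
    unfolding Cauchy_altdef
  proof (intro allI impI)
    fix e :: real assume "e > 0"
    then have "e\<^sup>2 > 0" by simp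
    with C obtain M where M: "\<And>m n. m \<ge> M \<Longrightarrow> n > m \<Longrightarrow> dist ((norm (p m))\<^sup>2) ((norm (p n))\<^sup>2) < e\<^sup>2"
      unfolding Cauchy_altdef by metis
    have "dist (p m) (p n) < e" if "m \<ge> M" "n > m" for m n
    proof -
      have "(norm (p n - p m))\<^sup>2 < e\<^sup>2"
        using key[of m n] M[OF that] that by (simp add: dist_real_def)
      then show ?thesis using \<open>e > 0\<close>
        by (metis dist_norm dist_commute less_imp_le power2_less_imp_less)
    qed
    then show "\<exists>M. \<forall>m\<ge>M. \<forall>n>m. dist (p m) (p n) < e" by blast
  qed
  then obtain y where y: "p \<longlonglongrightarrow> y" using Cauchy_convergent convergent_def by blast
  have "y \<in> K n" for n
  proof (rule Lim_in_closed_set[OF K(2) _ _ y])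
    show "eventually (\<lambda>m. p m \<in> K n) sequentially"
      using p(1) mono by (intro eventually_sequentiallyI[of n]) blast
  qed simp
  then show ?thesis unfolding K_def by blast
qed

section \<open>The vector lattice V\<close>

context form_domain
begin

lemma incl_zero: "AE x in \<xi>. \<iota> 0 x = 0"
  using incl_scaleR[of 0 0] by simp

lemma incl_minus: "AE x in \<xi>. \<iota> (- v) x = - \<iota> v x"
  using incl_scaleR[of "-1" v] by simp

lemma incl_diff: "AE x in \<xi>. \<iota> (v - w) x = \<iota> v x - \<iota> w x"
  using incl_add[of v "- w"] incl_minus[of w] by eventually_elim simp

lemma incl_eqI: "(AE x in \<xi>. \<iota> v x = \<iota> w x) \<Longrightarrow> v = w"
proof -
  assume "AE x in \<xi>. \<iota> v x = \<iota> w x"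
  with incl_diff[of v w] have "AE x in \<xi>. \<iota> (v - w) x = 0" by eventually_elim simp
  then show ?thesis using incl_inj by force
qed

text \<open>\<open>pos_part\<close> is a definite description. The vector (u + |u|)/2 satisfies it,
  and injectivity of the inclusion makes it the only one that does.\<close>

lemma incl_pos_part: "AE x in \<xi>. \<iota> (pos_part \<xi> \<iota> u) x = max (\<iota> u x) 0"
proof -
  obtain w where w: "AE x in \<xi>. \<iota> w x = \<bar>\<iota> u x\<bar>" using abs_in_V by blast
  have P: "AE x in \<xi>. \<iota> ((1/2) *\<^sub>R (u + w)) x = max (\<iota> u x) 0"
    using w incl_scaleR[of "1/2" "u + w"] incl_add[of u w] by eventually_elim auto
  show ?thesis
    unfolding pos_part_def
  proof (rule theI[of "\<lambda>w. AE x in \<xi>. \<iota> w x = max (\<iota> u x) 0", OF P])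
    fix y assume "AE x in \<xi>. \<iota> y x = max (\<iota> u x) 0"
    with P have "AE x in \<xi>. \<iota> y x = \<iota> ((1/2) *\<^sub>R (u + w)) x" by eventually_elim simp
    then show "y = (1/2) *\<^sub>R (u + w)" by (rule incl_eqI)
  qed
qed

lemma pos_part_in_V_plus: "pos_part \<xi> \<iota> u \<in> V_plus \<xi> \<iota>"
  using incl_pos_part[of u] by (auto simp: V_plus_def)

lemma pos_part_minus_neg_part: "pos_part \<xi> \<iota> u - pos_part \<xi> \<iota> (- u) = u"
proof (rule incl_eqI)
  show "AE x in \<xi>. \<iota> (pos_part \<xi> \<iota> u - pos_part \<xi> \<iota> (- u)) x = \<iota> u x"
    using incl_diff[of "pos_part \<xi> \<iota> u" "pos_part \<xi> \<iota> (- u)"] incl_pos_part[of u]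
      incl_pos_part[of "- u"] incl_minus[of u]
    by eventually_elim auto
qed

text \<open>The lattice minimum in the form u - (u - v)^+, so that its V-norm is controlled by
  \<kappa>.\<close>

definition vmin :: "'v \<Rightarrow> 'v \<Rightarrow> 'v" where
  "vmin u v = u - pos_part \<xi> \<iota> (u - v)"

lemma incl_vmin: "AE x in \<xi>. \<iota> (vmin u v) x = min (\<iota> u x) (\<iota> v x)"
  using incl_diff[of u "pos_part \<xi> \<iota> (u - v)"] incl_pos_part[of "u - v"] incl_diff[of u v]
  unfolding vmin_def by eventually_elim auto

lemma norm_vmin_le: "norm (vmin u v) \<le> (1 + \<kappa>) * norm u + \<kappa> * norm v"
proof -
  have "norm (vmin u v) \<le> norm u + \<kappa> * norm (u - v)"
    unfolding vmin_def using norm_triangle_ineq4 norm_pos_part_le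
    by (metis add_left_mono order_trans)
  also have "\<dots> \<le> norm u + \<kappa> * (norm u + norm v)"
    using kappa_pos norm_triangle_ineq4 by (intro add_left_mono mult_left_mono) auto
  finally show ?thesis by (simp add: algebra_simps)
qed

section \<open>Order and convex structure of the positive cone\<close>

lemma V_plus_add: "u \<in> V_plus \<xi> \<iota> \<Longrightarrow> v \<in> V_plus \<xi> \<iota> \<Longrightarrow> u + v \<in> V_plus \<xi> \<iota>"
proof -
  assume "u \<in> V_plus \<xi> \<iota>" "v \<in> V_plus \<xi> \<iota>"
  then have "AE x in \<xi>. \<iota> u x \<ge> 0" "AE x in \<xi>. \<iota> v x \<ge> 0" by (auto simp: V_plus_def)
  with incl_add[of u v] have "AE x in \<xi>. \<iota> (u + v) x \<ge> 0" by eventually_elim auto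
  then show ?thesis by (simp add: V_plus_def)
qed

lemma V_plus_scaleR: "v \<in> V_plus \<xi> \<iota> \<Longrightarrow> r \<ge> 0 \<Longrightarrow> r *\<^sub>R v \<in> V_plus \<xi> \<iota>"
proof -
  assume "v \<in> V_plus \<xi> \<iota>" "r \<ge> 0"
  then have "AE x in \<xi>. \<iota> v x \<ge> 0" by (auto simp: V_plus_def)
  with incl_scaleR[of r v] have "AE x in \<xi>. \<iota> (r *\<^sub>R v) x \<ge> 0"
    by eventually_elim (use \<open>r \<ge> 0\<close> in auto)
  then show ?thesis by (simp add: V_plus_def)
qed

lemma zero_in_V_plus: "0 \<in> V_plus \<xi> \<iota>"
  using incl_zero by (auto simp: V_plus_def)

lemma V_plus_diff_iff: "v - w \<in> V_plus \<xi> \<iota> \<longleftrightarrow> (AE x in \<xi>. \<iota> w x \<le> \<iota> v x)"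
proof
  assume "v - w \<in> V_plus \<xi> \<iota>"
  then have "AE x in \<xi>. \<iota> (v - w) x \<ge> 0" by (simp add: V_plus_def)
  with incl_diff[of v w] show "AE x in \<xi>. \<iota> w x \<le> \<iota> v x" by eventually_elim simp
next
  assume "AE x in \<xi>. \<iota> w x \<le> \<iota> v x"
  with incl_diff[of v w] have "AE x in \<xi>. \<iota> (v - w) x \<ge> 0" by eventually_elim simp
  then show "v - w \<in> V_plus \<xi> \<iota>" by (simp add: V_plus_def)
qed

lemma convex_V_plus: "convex (V_plus \<xi> \<iota>)"
  by (auto simp: convex_def intro: V_plus_add V_plus_scaleR)

section \<open>The L^2 norm on V\<close>

lemma incl_measurable [measurable]: "\<iota> v \<in> borel_measurable \<xi>"
  using incl_L2[of v] by (simp add: L2_def)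

lemma incl_integrable_sq: "integrable \<xi> (\<lambda>x. (\<iota> v x)\<^sup>2)"
  using incl_L2[of v] by (simp add: L2_def)

text \<open>The squared norm is enough: the quasi-triangle inequality and the convexity of balls
  then follow by integrating pointwise inequalities.\<close>

definition L2_sq :: "'v \<Rightarrow> real" where
  "L2_sq v = (\<integral>x. (\<iota> v x)\<^sup>2 \<partial>\<xi>)"

lemma L2_sq_nonneg: "L2_sq v \<ge> 0"
  unfolding L2_sq_def by simp

lemma L2_sq_mono: "(AE x in \<xi>. \<bar>\<iota> v x\<bar> \<le> \<bar>\<iota> w x\<bar>) \<Longrightarrow> L2_sq v \<le> L2_sq w"
proof -
  assume "AE x in \<xi>. \<bar>\<iota> v x\<bar> \<le> \<bar>\<iota> w x\<bar>"
  then have "AE x in \<xi>. (\<iota> v x)\<^sup>2 \<le> (\<iota> w x)\<^sup>2" by eventually_elim (simp add: abs_le_square_iff)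
  then show ?thesis unfolding L2_sq_def by (intro integral_mono_AE incl_integrable_sq)
qed

lemma L2_sq_eq_0D: "L2_sq v = 0 \<Longrightarrow> v = 0"
proof -
  assume "L2_sq v = 0"
  then have "AE x in \<xi>. (\<iota> v x)\<^sup>2 = 0"
    unfolding L2_sq_def by (subst (asm) integral_nonneg_eq_0_iff_AE[OF incl_integrable_sq]) auto
  then have "AE x in \<xi>. \<iota> v x = 0" by eventually_elim simp
  then show "v = 0" by (rule incl_inj)
qed

lemma L2_sq_le_norm: "\<exists>C\<ge>0. \<forall>v. L2_sq v \<le> C * (norm v)\<^sup>2"
proof -
  obtain C where C: "\<And>v. L2_norm \<xi> (\<iota> v) \<le> C * norm v" using incl_continuous by blast
  have "L2_sq v \<le> C\<^sup>2 * (norm v)\<^sup>2" for v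
  proof -
    have "L2_sq v = (L2_norm \<xi> (\<iota> v))\<^sup>2" using L2_sq_nonneg[of v] by (simp add: L2_norm_def L2_sq_def)
    also have "\<dots> \<le> (C * norm v)\<^sup>2"
      using C[of v] L2_sq_nonneg[of v] by (intro power_mono) (auto simp: L2_norm_def)
    finally show ?thesis by (simp add: power_mult_distrib)
  qed
  then show ?thesis by (intro exI[of _ "C\<^sup>2"]) auto
qed

lemma L2_sq_add_le: "L2_sq (v + w) \<le> 2 * L2_sq v + 2 * L2_sq w"
proof -
  have "AE x in \<xi>. (\<iota> (v + w) x)\<^sup>2 \<le> 2 * (\<iota> v x)\<^sup>2 + 2 * (\<iota> w x)\<^sup>2"
    using incl_add[of v w]
  proof eventually_elim
    case (elim x)
    have "0 \<le> (\<iota> v x - \<iota> w x)\<^sup>2" by simp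
    with elim show ?case by (simp add: power2_eq_square algebra_simps)
  qed
  then have "L2_sq (v + w) \<le> (\<integral>x. 2 * (\<iota> v x)\<^sup>2 + 2 * (\<iota> w x)\<^sup>2 \<partial>\<xi>)"
    unfolding L2_sq_def
    by (intro integral_mono_AE incl_integrable_sq Bochner_Integration.integrable_add integrable_mult_right) auto
  also have "\<dots> = 2 * L2_sq v + 2 * L2_sq w"
    unfolding L2_sq_def using incl_integrable_sq by simp
  finally show ?thesis .
qed

lemma convex_L2_sq_ball: "convex {y. L2_sq (y - v) \<le> e}"
proof (rule convexI, clarsimp)
  fix y z :: 'v and a b :: real
  assume *: "L2_sq (y - v) \<le> e" "L2_sq (z - v) \<le> e" "0 \<le> a" "0 \<le> b" "a + b = 1"
  have "AE x in \<xi>. (\<iota> (a *\<^sub>R y + b *\<^sub>R z - v) x)\<^sup>2 \<le> a * (\<iota> (y - v) x)\<^sup>2 + b * (\<iota> (z - v) x)\<^sup>2"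
    using incl_diff[of "a *\<^sub>R y + b *\<^sub>R z" v] incl_add[of "a *\<^sub>R y" "b *\<^sub>R z"]
      incl_scaleR[of a y] incl_scaleR[of b z] incl_diff[of y v] incl_diff[of z v]
  proof eventually_elim
    case (elim x)
    have b: "b = 1 - a" using * by simp
    \<comment> \<open>The exact convexity defect of the square, which is visibly
      nonnegative.\<close>
    have "a * (\<iota> y x - \<iota> v x)\<^sup>2 + b * (\<iota> z x - \<iota> v x)\<^sup>2
        - (a * \<iota> y x + b * \<iota> z x - \<iota> v x)\<^sup>2 = a * b * (\<iota> y x - \<iota> z x)\<^sup>2"
      unfolding b by (simp add: power2_eq_square algebra_simps)
    also have "\<dots> \<ge> 0" using * by simp
    finally show ?case using elim by simp
  qed
  then have "L2_sq (a *\<^sub>R y + b *\<^sub>R z - v) \<le> (\<integral>x. a * (\<iota> (y - v) x)\<^sup>2 + b * (\<iota> (z - v) x)\<^sup>2 \<partial>\<xi>)"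
    unfolding L2_sq_def
    by (intro integral_mono_AE incl_integrable_sq Bochner_Integration.integrable_add integrable_mult_right) auto
  also have "\<dots> = a * L2_sq (y - v) + b * L2_sq (z - v)"
    unfolding L2_sq_def using incl_integrable_sq by simp
  also have "\<dots> \<le> a * e + b * e" using * by (intro add_mono mult_left_mono) auto
  also have "\<dots> = e" using * by (simp add: distrib_right[symmetric])
  finally show "L2_sq (a *\<^sub>R y + b *\<^sub>R z - v) \<le> e" .
qed

text \<open>If s_n \<ge> 0 converges to l, the negative part of l is pointwise at most |s_n - l|.
  Its L^2 norm therefore vanishes, and with it the negative part.\<close>

lemma closed_V_plus: "closed (V_plus \<xi> \<iota>)"
  unfolding closed_sequential_limits
proof (intro allI impI, elim conjE)
  fix s l assume s: "\<forall>n. s n \<in> V_plus \<xi> \<iota>" and l: "s \<longlonglongrightarrow> l"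
  obtain C where C: "\<And>v. L2_sq v \<le> C * (norm v)\<^sup>2" using L2_sq_le_norm by blast
  have "L2_sq (pos_part \<xi> \<iota> (- l)) \<le> C * (norm (s n - l))\<^sup>2" for n
  proof -
    have "AE x in \<xi>. \<iota> (s n) x \<ge> 0" using s by (auto simp: V_plus_def)
    then have "AE x in \<xi>. \<bar>\<iota> (pos_part \<xi> \<iota> (- l)) x\<bar> \<le> \<bar>\<iota> (s n - l) x\<bar>"
      using incl_pos_part[of "- l"] incl_minus[of l] incl_diff[of "s n" l]
      by eventually_elim auto
    then show ?thesis using L2_sq_mono C order_trans by blast
  qed
  moreover have "(\<lambda>n. C * (norm (s n - l))\<^sup>2) \<longlonglongrightarrow> C * (norm (l - l))\<^sup>2" by (intro tendsto_intros l)
  ultimately have "L2_sq (pos_part \<xi> \<iota> (- l)) \<le> C * (norm (l - l))\<^sup>2"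
    by (intro LIMSEQ_le_const) auto
  then have "pos_part \<xi> \<iota> (- l) = 0" using L2_sq_nonneg by (intro L2_sq_eq_0D antisym) auto
  with pos_part_minus_neg_part[of l] have "l = pos_part \<xi> \<iota> l" by simp
  then show "l \<in> V_plus \<xi> \<iota>" using pos_part_in_V_plus by metis
qed

text \<open>A sequence that is bounded in V and converges in $L^2$ converges weakly in V.\<close>

lemma L2_limit_in_closure:
  assumes bdd: "bounded (range w)" and lim: "(\<lambda>n. L2_sq (w n - v)) \<longlonglongrightarrow> 0"
    and S: "convex S" "\<And>n. w n \<in> S"
  shows "v \<in> closure S"
proof -
  obtain y where y: "\<And>n. y \<in> closure (convex hull (w ` {n..}))"
    using bounded_seq_convex_cluster_point[OF bdd] by blast
  obtain C where C: "C \<ge> 0" "\<And>v. L2_sq v \<le> C * (norm v)\<^sup>2" using L2_sq_le_norm by blast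
  \<comment> \<open>The cluster point \<open>y\<close> must be \<open>v\<close>: the hulls of late
    tails lie in small L^2 balls around \<open>v\<close>, and \<open>y\<close> is V-close, hence
    L^2-close, to such a hull. The quarters of \<open>e\<close> absorb the factors 2 of
    \<open>L2_sq_add_le\<close>.\<close>
  have "L2_sq (y - v) \<le> 0 + e" if "e > 0" for e
  proof -
    have "eventually (\<lambda>n. L2_sq (w n - v) < e / 4) sequentially"
      using lim \<open>e > 0\<close> by (intro order_tendstoD) auto
    then obtain N where N: "\<And>n. n \<ge> N \<Longrightarrow> L2_sq (w n - v) < e / 4"
      by (auto simp: eventually_sequentially)
    have hull: "convex hull (w ` {N..}) \<subseteq> {y. L2_sq (y - v) \<le> e / 4}"
      using N by (intro hull_minimal convex_L2_sq_ball) (auto intro: less_imp_le)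
    define r where "r = sqrt (e / (4 * (C + 1)))"
    have "r > 0" using \<open>e > 0\<close> C by (simp add: r_def)
    then obtain z where z: "z \<in> convex hull (w ` {N..})" "dist z y < r"
      using y[of N] unfolding closure_approachable by blast
    have "L2_sq (y - z) \<le> C * r\<^sup>2"
      using C(2)[of "y - z"] z(2) C(1)
      by (smt (verit) dist_commute dist_norm mult_left_mono norm_ge_zero power_mono)
    also have "\<dots> \<le> e / 4"
      using C(1) \<open>e > 0\<close> by (simp add: r_def field_simps)
    finally have "L2_sq (y - z) \<le> e / 4" .
    moreover have "L2_sq (z - v) \<le> e / 4" using hull z by blast
    ultimately show ?thesis using L2_sq_add_le[of "y - z" "z - v"] by simp
  qed
  then have "L2_sq (y - v) \<le> 0" by (rule field_le_epsilon)
  then have "y = v" using L2_sq_nonneg[of "y - v"] L2_sq_eq_0D[of "y - v"] by auto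
  moreover have "convex hull (w ` {0..}) \<subseteq> S" using S by (intro hull_minimal) auto
  ultimately show ?thesis using y[of 0] closure_mono by blast
qed

end

section \<open>Polyhedricity of the positive cone\<close>

context form_domain
begin

text \<open>By convexity one positive step suffices, since all shorter steps are then admissible too
  (\<open>V_plus_segment\<close>). The closure is the tangent cone at \<open>z\<close>.\<close>

definition radial_cone :: "'v \<Rightarrow> 'v set" where
  "radial_cone z = {v. \<exists>t>0. z + t *\<^sub>R v \<in> V_plus \<xi> \<iota>}"

text \<open>The closure is taken after intersecting with the kernel, so that its elements are limits
  of radial directions annihilated by \<open>l\<close>; these are the test directions admissible for
  difference quotients. That closing first would give nothing larger, for positive \<open>l\<close>
  vanishing at \<open>z\<close>, is the content of \<open>polyhedric_V_plus\<close>.\<close>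

definition critical_cone :: "('v \<Rightarrow>\<^sub>L real) \<Rightarrow> 'v \<Rightarrow> 'v set" where
  "critical_cone l z = closure (radial_cone z \<inter> {v. blinfun_apply l v = 0})"

lemma V_plus_segment:
  assumes "z \<in> V_plus \<xi> \<iota>" "z + t *\<^sub>R v \<in> V_plus \<xi> \<iota>" "0 \<le> s" "s \<le> t" "t > 0"
  shows "z + s *\<^sub>R v \<in> V_plus \<xi> \<iota>"
proof -
  have "(1 - s / t) *\<^sub>R z + (s / t) *\<^sub>R (z + t *\<^sub>R v) \<in> V_plus \<xi> \<iota>"
    using assms by (intro convexD[OF convex_V_plus]) (auto simp: field_simps)
  moreover have "(1 - s / t) *\<^sub>R z + (s / t) *\<^sub>R (z + t *\<^sub>R v) = z + s *\<^sub>R v"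
    using assms(5) by (simp add: algebra_simps)
  ultimately show ?thesis by simp
qed

lemma convex_radial_cone:
  assumes z: "z \<in> V_plus \<xi> \<iota>"
  shows "convex (radial_cone z)"
proof (rule convexI)
  fix v w and a b :: real
  assume vw: "v \<in> radial_cone z" "w \<in> radial_cone z" and ab: "0 \<le> a" "0 \<le> b" "a + b = 1"
  obtain s t where st: "s > 0" "z + s *\<^sub>R v \<in> V_plus \<xi> \<iota>" "t > 0" "z + t *\<^sub>R w \<in> V_plus \<xi> \<iota>"
    using vw by (auto simp: radial_cone_def)
  define m where "m = min s t"
  have m: "m > 0" "z + m *\<^sub>R v \<in> V_plus \<xi> \<iota>" "z + m *\<^sub>R w \<in> V_plus \<xi> \<iota>"
    using st V_plus_segment[OF z st(2), of m] V_plus_segment[OF z st(4), of m] by (auto simp: m_def)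
  have "a *\<^sub>R (z + m *\<^sub>R v) + b *\<^sub>R (z + m *\<^sub>R w) \<in> V_plus \<xi> \<iota>"
    using m ab by (intro convexD[OF convex_V_plus]) auto
  moreover have "a *\<^sub>R (z + m *\<^sub>R v) + b *\<^sub>R (z + m *\<^sub>R w) = (a + b) *\<^sub>R z + m *\<^sub>R (a *\<^sub>R v + b *\<^sub>R w)"
    by (simp add: algebra_simps)
  ultimately show "a *\<^sub>R v + b *\<^sub>R w \<in> radial_cone z"
    using m(1) ab(3) by (auto simp: radial_cone_def)
qed

lemma V_plus_subset_radial_cone: "z \<in> V_plus \<xi> \<iota> \<Longrightarrow> V_plus \<xi> \<iota> \<subseteq> radial_cone z"
  unfolding radial_cone_def using V_plus_add by (auto intro!: exI[of _ 1])

lemma convex_ker: "convex {v. blinfun_apply l v = (0::real)}"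
  by (auto simp: convex_def blinfun.add_right blinfun.scaleR_right)

lemma closed_ker: "closed {v. blinfun_apply l v = (0::real)}"
  by (intro closed_Collect_eq continuous_intros)

lemma convex_critical_cone: "z \<in> V_plus \<xi> \<iota> \<Longrightarrow> convex (critical_cone l z)"
  unfolding critical_cone_def by (intro convex_closure convex_Int convex_radial_cone convex_ker)

lemma zero_in_critical_cone: "z \<in> V_plus \<xi> \<iota> \<Longrightarrow> 0 \<in> critical_cone l z"
proof -
  assume "z \<in> V_plus \<xi> \<iota>"
  then have "0 \<in> radial_cone z \<inter> {v. blinfun_apply l v = 0}"
    using V_plus_subset_radial_cone zero_in_V_plus by (auto simp: blinfun.zero_right)
  then show ?thesis unfolding critical_cone_def by (rule subsetD[OF closure_subset])
qed

lemma L2_sq_tendsto_0: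
  assumes "s \<longlonglongrightarrow> v"
  shows "(\<lambda>n. L2_sq (c *\<^sub>R (s n - v))) \<longlonglongrightarrow> 0"
proof -
  obtain C where C: "\<And>v. L2_sq v \<le> C * (norm v)\<^sup>2" using L2_sq_le_norm by blast
  have "(\<lambda>n. C * (norm (c *\<^sub>R (s n - v)))\<^sup>2) \<longlonglongrightarrow> C * (norm (c *\<^sub>R (v - v)))\<^sup>2"
    by (intro tendsto_intros assms)
  then have upper: "(\<lambda>n. C * (norm (c *\<^sub>R (s n - v)))\<^sup>2) \<longlonglongrightarrow> 0" by simp
  show ?thesis
    by (intro tendsto_sandwich[OF always_eventually always_eventually tendsto_const upper] allI
        L2_sq_nonneg C)
qed

text \<open>Radial approximants s_n of v need not be annihilated by \<open>l\<close>, so they are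
  replaced by min(v^+, s_n^+) - s_n^-. The negative parts are dominated by multiples of z, where
  \<open>l\<close> vanishes; the positive parts lie between 0 and v^+, which \<open>l\<close> also
  annihilates. These vectors are bounded in V and converge to v in L^2, which is enough because the
  target set is convex.\<close>

lemma polyhedric_V_plus:
  assumes z: "z \<in> V_plus \<xi> \<iota>"
    and l_nonneg: "\<And>w. w \<in> V_plus \<xi> \<iota> \<Longrightarrow> blinfun_apply l w \<ge> 0"
    and l_z: "blinfun_apply l z = 0"
    and v: "v \<in> closure (radial_cone z)"
    and l_v: "blinfun_apply l v = 0"
  shows "v \<in> critical_cone l z"
proof -
  let ?P = "pos_part \<xi> \<iota>"
  obtain s where s: "\<And>n. s n \<in> radial_cone z" and lim: "s \<longlonglongrightarrow> v"
    using v unfolding closure_sequential by auto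
  obtain B where B: "\<And>n. norm (s n) \<le> B"
    using convergent_imp_bounded[OF lim] by (auto simp: bounded_iff)
  \<comment> \<open>From z \<ge> 0 and z + t s_n \<ge> 0 it follows that t s_n^- \<le> z. This both
    makes -s_n^- radial and yields the vanishing of \<open>l\<close> on s_n^-.\<close>
  have neg: "\<exists>t>0. z - t *\<^sub>R ?P (- s n) \<in> V_plus \<xi> \<iota>" for n
  proof -
    obtain t where t: "t > 0" "z + t *\<^sub>R s n \<in> V_plus \<xi> \<iota>" using s by (auto simp: radial_cone_def)
    from t(2) have "AE x in \<xi>. \<iota> (z + t *\<^sub>R s n) x \<ge> 0" by (simp add: V_plus_def)
    moreover have "AE x in \<xi>. \<iota> z x \<ge> 0" using z by (simp add: V_plus_def)
    ultimately have "AE x in \<xi>. \<iota> (t *\<^sub>R ?P (- s n)) x \<le> \<iota> z x"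
      using incl_add[of z "t *\<^sub>R s n"] incl_scaleR[of t "s n"] incl_scaleR[of t "?P (- s n)"]
        incl_pos_part[of "- s n"] incl_minus[of "s n"]
    proof eventually_elim
      case (elim x)
      then show ?case by (auto simp: max_def)
    qed
    with t(1) show ?thesis by (auto simp: V_plus_diff_iff)
  qed
  have l_neg: "blinfun_apply l (?P (- s n)) = 0" for n
  proof -
    obtain t where t: "t > 0" "z - t *\<^sub>R ?P (- s n) \<in> V_plus \<xi> \<iota>" using neg by blast
    have "0 \<le> - t * blinfun_apply l (?P (- s n))"
      using l_nonneg[OF t(2)] l_z by (simp add: blinfun.diff_right blinfun.scaleR_right)
    with t(1) have "blinfun_apply l (?P (- s n)) \<le> 0" by (simp add: mult_le_0_iff)
    with l_nonneg[OF pos_part_in_V_plus] show ?thesis by (intro antisym)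
  qed
  have neg_bound: "norm (?P (- s n)) \<le> \<kappa> * B" for n
    using norm_pos_part_le[of "- s n"] B[of n] kappa_pos
    by (metis mult_le_cancel_left_pos norm_minus_cancel order_trans)
  have pos_bound: "norm (?P (s n)) \<le> \<kappa> * B" for n
    using norm_pos_part_le[of "s n"] B[of n] kappa_pos
    by (metis mult_le_cancel_left_pos order_trans)
  have "?P (- v) \<in> closure {v. blinfun_apply l v = 0}"
  proof (rule L2_limit_in_closure)
    show "bounded (range (\<lambda>n. ?P (- s n)))"
      using neg_bound by (auto simp: bounded_iff)
    have "L2_sq (?P (- s n) - ?P (- v)) \<le> L2_sq (1 *\<^sub>R (s n - v))" for n
    proof (rule L2_sq_mono)
      show "AE x in \<xi>. \<bar>\<iota> (?P (- s n) - ?P (- v)) x\<bar> \<le> \<bar>\<iota> (1 *\<^sub>R (s n - v)) x\<bar>"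
        using incl_diff[of "?P (- s n)" "?P (- v)"] incl_pos_part[of "- s n"] incl_pos_part[of "- v"]
          incl_minus[of "s n"] incl_minus[of v] incl_diff[of "s n" v]
      proof eventually_elim
        case (elim x)
        then show ?case by (auto simp: max_def)
      qed
    qed
    then show "(\<lambda>n. L2_sq (?P (- s n) - ?P (- v))) \<longlonglongrightarrow> 0"
      by (intro tendsto_sandwich[OF always_eventually always_eventually tendsto_const
            L2_sq_tendsto_0[OF lim, of 1]] allI L2_sq_nonneg)
  qed (use l_neg convex_ker in auto)
  then have "blinfun_apply l (?P (- v)) = 0"
    using closed_ker[of l] by (simp add: closure_closed)
  then have l_pos: "blinfun_apply l (?P v) = 0"
    using pos_part_minus_neg_part[of v] l_v by (metis blinfun.diff_right diff_zero)
  define w where "w n = vmin (?P v) (?P (s n)) - ?P (- s n)" for n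
  have wS: "w n \<in> radial_cone z \<inter> {v. blinfun_apply l v = 0}" for n
  proof
    have min: "vmin (?P v) (?P (s n)) \<in> V_plus \<xi> \<iota>"
    proof -
      have "AE x in \<xi>. \<iota> (vmin (?P v) (?P (s n))) x \<ge> 0"
        using incl_vmin[of "?P v" "?P (s n)"] incl_pos_part[of v] incl_pos_part[of "s n"]
        by eventually_elim auto
      then show ?thesis by (simp add: V_plus_def)
    qed
    have "AE x in \<xi>. \<iota> (vmin (?P v) (?P (s n))) x \<le> \<iota> (?P v) x"
      using incl_vmin[of "?P v" "?P (s n)"] by eventually_elim auto
    then have "blinfun_apply l (?P v - vmin (?P v) (?P (s n))) \<ge> 0"
      by (intro l_nonneg) (simp add: V_plus_diff_iff)
    then have "blinfun_apply l (vmin (?P v) (?P (s n))) = 0"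
      using l_nonneg[OF min] l_pos by (simp add: blinfun.diff_right)
    then show "w n \<in> {v. blinfun_apply l v = 0}" by (simp add: w_def blinfun.diff_right l_neg)
    obtain t where t: "t > 0" "z - t *\<^sub>R ?P (- s n) \<in> V_plus \<xi> \<iota>" using neg by blast
    have "t *\<^sub>R vmin (?P v) (?P (s n)) + (z - t *\<^sub>R ?P (- s n)) \<in> V_plus \<xi> \<iota>"
      using t min by (intro V_plus_add V_plus_scaleR) auto
    then have "z + t *\<^sub>R w n \<in> V_plus \<xi> \<iota>" by (simp add: w_def algebra_simps)
    with t(1) show "w n \<in> radial_cone z" by (auto simp: radial_cone_def)
  qed
  show ?thesis
    unfolding critical_cone_def
  proof (rule L2_limit_in_closure)
    have "norm (w n) \<le> (1 + \<kappa>) * norm (?P v) + \<kappa> * (\<kappa> * B) + \<kappa> * B" for n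
    proof -
      have "norm (w n) \<le> norm (vmin (?P v) (?P (s n))) + norm (?P (- s n))"
        unfolding w_def by (rule norm_triangle_ineq4)
      also have "\<dots> \<le> ((1 + \<kappa>) * norm (?P v) + \<kappa> * norm (?P (s n))) + \<kappa> * B"
        by (intro add_mono norm_vmin_le neg_bound)
      also have "\<dots> \<le> ((1 + \<kappa>) * norm (?P v) + \<kappa> * (\<kappa> * B)) + \<kappa> * B"
        using kappa_pos pos_bound[of n] by (intro add_right_mono add_left_mono mult_left_mono) auto
      finally show ?thesis .
    qed
    then show "bounded (range w)" by (auto simp: bounded_iff)
    \<comment> \<open>One multiple of |s_n - v| comes from exchanging min(v^+, s_n^+) for v^+, the
      other from exchanging s_n^- for v^-.\<close>
    have "L2_sq (w n - v) \<le> L2_sq (2 *\<^sub>R (s n - v))" for n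
    proof (rule L2_sq_mono)
      show "AE x in \<xi>. \<bar>\<iota> (w n - v) x\<bar> \<le> \<bar>\<iota> (2 *\<^sub>R (s n - v)) x\<bar>"
        using incl_diff[of "w n" v] incl_diff[of "vmin (?P v) (?P (s n))" "?P (- s n)", folded w_def]
          incl_vmin[of "?P v" "?P (s n)"] incl_pos_part[of "- s n"] incl_pos_part[of "s n"]
          incl_pos_part[of v] incl_minus[of "s n"] incl_diff[of "s n" v] incl_scaleR[of 2 "s n - v"]
      proof eventually_elim
        case (elim x)
        have "\<bar>min (max a 0) (max b 0) - max (- b) 0 - a\<bar> \<le> \<bar>2 * (b - a)\<bar>" for a b :: real
          by (auto simp: min_def max_def)
        from this[of "\<iota> v x" "\<iota> (s n) x"] elim show ?case by simp
      qed
    qed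
    then show "(\<lambda>n. L2_sq (w n - v)) \<longlonglongrightarrow> 0"
      by (intro tendsto_sandwich[OF always_eventually always_eventually tendsto_const
            L2_sq_tendsto_0[OF lim, of 2]] allI L2_sq_nonneg)
  qed (use wS convex_radial_cone[OF z] convex_ker in \<open>auto intro: convex_Int\<close>)
qed

end

section \<open>Mignot's theorem\<close>

context qvi_setting
begin

lemma S0_solution:
  "S0 \<xi> \<iota> A g \<in> V_plus \<xi> \<iota> \<and> (\<forall>v\<in>V_plus \<xi> \<iota>. blinfun_apply (A (S0 \<xi> \<iota> A g) - g) (S0 \<xi> \<iota> A g - v) \<le> 0)"
  unfolding S0_def
  by (rule theI') (rule lions_stampacchia[OF convex_V_plus closed_V_plus _ A_linear A_bounded C\<^sub>a_pos A_coercive],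
    use zero_in_V_plus in blast)

lemma S0_eqI:
  assumes "z \<in> V_plus \<xi> \<iota>" "\<And>v. v \<in> V_plus \<xi> \<iota> \<Longrightarrow> blinfun_apply (A z - g) (z - v) \<le> 0"
  shows "S0 \<xi> \<iota> A g = z"
  using lions_stampacchia[OF convex_V_plus closed_V_plus _ A_linear A_bounded C\<^sub>a_pos A_coercive, of g]
    S0_solution[of g] assms zero_in_V_plus by blast

text \<open>Testing with z + w gives the sign on the cone; testing with 0 gives the reverse
  inequality at z itself.\<close>

lemma S0_complementarity:
  shows "w \<in> V_plus \<xi> \<iota> \<Longrightarrow> blinfun_apply (A (S0 \<xi> \<iota> A g) - g) w \<ge> 0"
    and "blinfun_apply (A (S0 \<xi> \<iota> A g) - g) (S0 \<xi> \<iota> A g) = 0"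
proof -
  define z where "z = S0 \<xi> \<iota> A g"
  have z: "z \<in> V_plus \<xi> \<iota>" and vi: "\<And>v. v \<in> V_plus \<xi> \<iota> \<Longrightarrow> blinfun_apply (A z - g) (z - v) \<le> 0"
    using S0_solution by (auto simp: z_def)
  have nonneg: "blinfun_apply (A z - g) w \<ge> 0" if "w \<in> V_plus \<xi> \<iota>" for w
    using vi[OF V_plus_add[OF z that]] by (simp add: blinfun.diff_right blinfun.minus_right)
  then show "w \<in> V_plus \<xi> \<iota> \<Longrightarrow> blinfun_apply (A (S0 \<xi> \<iota> A g) - g) w \<ge> 0" by (simp add: z_def)
  show "blinfun_apply (A (S0 \<xi> \<iota> A g) - g) (S0 \<xi> \<iota> A g) = 0"
    using nonneg[OF z] vi[OF zero_in_V_plus] by (simp add: z_def)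
qed

text \<open>Write the perturbed solution as z + t q(t). The quotients q(t) are bounded, radial, and
  satisfy l(q(t)) = O(t), so by polyhedricity their weak limit points lie in the critical cone
  \<open>C\<close>. The variational inequality on \<open>C\<close> identifies the limit, and
  coercivity upgrades weak to norm convergence.\<close>

lemma mignot:
  fixes g d :: "'v \<Rightarrow>\<^sub>L real"
  defines "z \<equiv> S0 \<xi> \<iota> A g"
  defines "C \<equiv> critical_cone (A z - g) z"
  shows "\<exists>\<eta>\<in>C. (\<forall>v\<in>C. blinfun_apply (A \<eta> - d) (\<eta> - v) \<le> 0) \<and>
    ((\<lambda>t. (S0 \<xi> \<iota> A (g + t *\<^sub>R d) - z) /\<^sub>R t) \<longlongrightarrow> \<eta>) (at_right 0)"
proof -
  note A_simps = linear_add[OF A_linear] linear_diff[OF A_linear] linear_scale[OF A_linear]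
    blinfun.diff_left blinfun.diff_right blinfun.add_left blinfun.add_right
    blinfun.scaleR_left blinfun.scaleR_right
  define l where "l = A z - g"
  have z: "z \<in> V_plus \<xi> \<iota>" using S0_solution by (simp add: z_def)
  have l_nonneg: "\<And>w. w \<in> V_plus \<xi> \<iota> \<Longrightarrow> blinfun_apply l w \<ge> 0" and l_z: "blinfun_apply l z = 0"
    using S0_complementarity by (auto simp: l_def z_def)
  have C_def': "C = critical_cone l z" by (simp add: C_def l_def)
  have "convex C" "closed C" using convex_critical_cone[OF z] by (auto simp: C_def critical_cone_def)
  moreover have "C \<noteq> {}" using zero_in_critical_cone[OF z] unfolding C_def by blast
  \<comment> \<open>The candidate for the derivative is found beforehand as the solution on
    \<open>C\<close>, so that only convergence to a known vector remains.\<close>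
  ultimately obtain \<eta> where \<eta>: "\<eta> \<in> C" "\<And>v. v \<in> C \<Longrightarrow> blinfun_apply (A \<eta> - d) (\<eta> - v) \<le> 0"
    using lions_stampacchia[OF _ _ _ A_linear A_bounded C\<^sub>a_pos A_coercive, of C d] by blast
  define q where "q t = (S0 \<xi> \<iota> A (g + t *\<^sub>R d) - z) /\<^sub>R t" for t :: real
  have zt: "S0 \<xi> \<iota> A (g + t *\<^sub>R d) = z + t *\<^sub>R q t" if "t > 0" for t
    using that by (simp add: q_def)
  have q_V: "z + t *\<^sub>R q t \<in> V_plus \<xi> \<iota>" if "t > 0" for t
    using S0_solution[of "g + t *\<^sub>R d"] by (simp add: zt[OF that])
  have q_radial: "q t \<in> radial_cone z" if "t > 0" for t
    using q_V[OF that] that by (auto simp: radial_cone_def)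
  have l_q: "blinfun_apply l (q t) \<ge> 0" if "t > 0" for t
    using l_nonneg[OF q_V[OF that]] l_z that by (simp add: A_simps zero_le_mult_iff)
  \<comment> \<open>The inequality for the perturbed solution, tested with z + t v and divided by t.
    The terms l(z) and l(v) vanish, and l(q(t)) \<ge> 0 is kept because it carries the estimate
    \<open>l_q_le\<close>.\<close>
  have vi: "blinfun_apply l (q t) + t * blinfun_apply (A (q t) - d) (q t - v) \<le> 0"
    if "t > 0" "z + t *\<^sub>R v \<in> V_plus \<xi> \<iota>" "blinfun_apply l v = 0" for t v
  proof -
    have "blinfun_apply (A (z + t *\<^sub>R q t) - (g + t *\<^sub>R d)) (z + t *\<^sub>R q t - (z + t *\<^sub>R v)) \<le> 0"
      using S0_solution[of "g + t *\<^sub>R d", unfolded zt[OF that(1)]] that(2) by blast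
    also have "A (z + t *\<^sub>R q t) - (g + t *\<^sub>R d) = l + t *\<^sub>R (A (q t) - d)"
      by (simp add: l_def linear_add[OF A_linear] linear_scale[OF A_linear] algebra_simps)
    also have "z + t *\<^sub>R q t - (z + t *\<^sub>R v) = t *\<^sub>R (q t - v)" by (simp add: algebra_simps)
    also have "blinfun_apply (l + t *\<^sub>R (A (q t) - d)) (t *\<^sub>R (q t - v))
        = t * (blinfun_apply l (q t) + t * blinfun_apply (A (q t) - d) (q t - v))"
      using that(3) by (simp add: A_simps algebra_simps)
    finally show ?thesis using that(1) by (simp add: mult_le_0_iff)
  qed
  define B where "B = norm d / C\<^sub>a"
  have B: "B \<ge> 0" using C\<^sub>a_pos by (simp add: B_def)
  have vi0: "blinfun_apply l (q t) + t * blinfun_apply (A (q t) - d) (q t) \<le> 0" if "t > 0" for t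
    using vi[of t 0] that z by (simp add: blinfun.zero_right)
  have q_B: "norm (q t) \<le> B" if "t > 0" for t
  proof -
    have "t * blinfun_apply (A (q t) - d) (q t) \<le> 0" using vi0[OF that] l_q[OF that] by linarith
    then have "blinfun_apply (A (q t)) (q t) \<le> blinfun_apply d (q t)"
      using that by (simp add: mult_le_0_iff A_simps)
    also have "\<dots> \<le> norm d * norm (q t)" using norm_blinfun[of d "q t"] by simp
    finally have "C\<^sub>a * (norm (q t))\<^sup>2 \<le> norm d * norm (q t)" using A_coercive[of "q t"] by linarith
    then have "C\<^sub>a * norm (q t) \<le> norm d"
      by (cases "q t = 0") (auto simp: power2_eq_square mult.assoc[symmetric])
    then show ?thesis using C\<^sub>a_pos by (simp add: B_def field_simps)
  qed
  have l_q_le: "blinfun_apply l (q t) \<le> t * (norm d * B)" if "t > 0" for t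
  proof -
    have "blinfun_apply d (q t) \<le> norm d * norm (q t)" using norm_blinfun[of d "q t"] by simp
    also have "\<dots> \<le> norm d * B" using q_B[OF that] by (intro mult_left_mono) auto
    finally have d: "blinfun_apply d (q t) \<le> norm d * B" .
    have "0 \<le> C\<^sub>a * (norm (q t))\<^sup>2" using C\<^sub>a_pos by simp
    then have "- (norm d * B) \<le> blinfun_apply (A (q t) - d) (q t)"
      using A_coercive[of "q t"] d unfolding blinfun.diff_left by linarith
    then have "t * (- (norm d * B)) \<le> t * blinfun_apply (A (q t) - d) (q t)"
      using that by (intro mult_left_mono) auto
    then show ?thesis using vi0[OF that] by simp
  qed
  have "(q \<longlongrightarrow> \<eta>) (at_right 0)"
    unfolding tendsto_at_iff_sequentially
  proof (intro allI impI)
    fix X :: "nat \<Rightarrow> real"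
    assume "\<forall>i. X i \<in> {0<..} - {0}" and lim: "X \<longlonglongrightarrow> 0"
    then have X: "X i > 0" for i by auto
    \<comment> \<open>\<open>\<eta>\<close> need not be radial, so it is replaced by a radial
      \<open>v\<close> annihilated by \<open>l\<close>, which is an admissible test once
      \<open>X i\<close> < \<open>t\<close>. \<open>D\<close> bounds the functional A q - d; its
      summand 1 keeps it positive.\<close>
    have upper1: "eventually (\<lambda>i. blinfun_apply (A (q (X i)) - d) (q (X i) - \<eta>) \<le> e) sequentially"
      if "e > 0" for e
    proof -
      define D where "D = \<bar>C\<^sub>b\<bar> * B + norm d + 1"
      have D: "D > 0" using B by (simp add: D_def add_nonneg_pos)
      obtain v where v: "v \<in> radial_cone z" "blinfun_apply l v = 0" "dist v \<eta> < e / D"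
        using \<eta>(1) D \<open>e > 0\<close> unfolding C_def' critical_cone_def closure_approachable
        by (metis (mono_tags, lifting) Int_iff divide_pos_pos mem_Collect_eq)
      obtain t where t: "t > 0" "z + t *\<^sub>R v \<in> V_plus \<xi> \<iota>" using v(1) by (auto simp: radial_cone_def)
      have "eventually (\<lambda>i. X i < t) sequentially" using lim t(1) by (rule order_tendstoD)
      then show ?thesis
      proof eventually_elim
        case (elim i)
        let ?q = "q (X i)"
        have "z + X i *\<^sub>R v \<in> V_plus \<xi> \<iota>"
          using V_plus_segment[OF z t(2)] X[of i] t(1) elim by simp
        from vi[OF X this v(2)] l_q[OF X, of i] have "X i * blinfun_apply (A ?q - d) (?q - v) \<le> 0" by linarith
        then have 1: "blinfun_apply (A ?q - d) (?q - v) \<le> 0" using X[of i] by (simp add: mult_le_0_iff)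
        have "blinfun_apply (A ?q) (v - \<eta>) \<le> C\<^sub>b * (norm ?q * norm (v - \<eta>))"
          using A_bounded[of ?q "v - \<eta>"] by (simp add: mult.assoc)
        also have "\<dots> \<le> \<bar>C\<^sub>b\<bar> * (B * norm (v - \<eta>))"
          using q_B[OF X, of i] B by (intro mult_mono) auto
        finally have 2: "blinfun_apply (A ?q) (v - \<eta>) \<le> \<bar>C\<^sub>b\<bar> * B * norm (v - \<eta>)" by (simp add: mult.assoc)
        have 3: "- blinfun_apply d (v - \<eta>) \<le> norm d * norm (v - \<eta>)"
          using norm_blinfun[of d "v - \<eta>"] by simp
        have "blinfun_apply (A ?q - d) (?q - \<eta>)
            = blinfun_apply (A ?q - d) (?q - v) + blinfun_apply (A ?q) (v - \<eta>) - blinfun_apply d (v - \<eta>)"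
          by (simp add: blinfun.diff_left blinfun.diff_right)
        also have "\<dots> \<le> \<bar>C\<^sub>b\<bar> * B * norm (v - \<eta>) + norm d * norm (v - \<eta>)" using 1 2 3 by linarith
        also have "\<dots> \<le> D * norm (v - \<eta>)" by (simp add: D_def algebra_simps)
        also have "\<dots> \<le> D * (e / D)" using v(3) D by (intro mult_left_mono) (auto simp: dist_norm)
        finally show ?case using D by simp
      qed
    qed
    \<comment> \<open>Otherwise a subsequence stays in a closed half-space that no element of
      \<open>C\<close> can meet, by the inequality for \<open>\<eta>\<close>. Its cluster point
      \<open>y\<close> lies both in that half-space and in \<open>C\<close>.\<close>
    have upper2: "eventually (\<lambda>i. blinfun_apply (A \<eta> - d) (\<eta> - q (X i)) \<le> e) sequentially"
      if "e > 0" for e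
    proof (rule ccontr)
      assume "\<not> ?thesis"
      from not_eventually_sequentiallyD[OF this]
      obtain r :: "nat \<Rightarrow> nat" where r: "strict_mono r" "\<And>n. \<not> blinfun_apply (A \<eta> - d) (\<eta> - q (X (r n))) \<le> e" by blast
      define Y where "Y n = q (X (r n))" for n
      have "bounded (range Y)" using q_B[OF X] by (auto simp: bounded_iff Y_def)
      from bounded_seq_convex_cluster_point[OF this]
      obtain y where y: "\<And>n. y \<in> closure (convex hull (Y ` {n..}))" by blast
      have y_in: "y \<in> S" if "closed S" "convex S" "\<And>n. n \<ge> N \<Longrightarrow> Y n \<in> S" for S N
      proof -
        have "closure (convex hull (Y ` {N..})) \<subseteq> S"
          using that by (intro closure_minimal hull_minimal) auto
        with y show ?thesis by blast
      qed
      have "y \<in> closure (radial_cone z)"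
        using convex_radial_cone[OF z] q_radial[OF X]
        by (intro y_in[where N = 0] convex_closure subsetD[OF closure_subset]) (auto simp: Y_def)
      moreover have "blinfun_apply l y = 0"
      proof -
        have "blinfun_apply l y \<le> 0 + b" if "b > 0" for b
        proof -
          have "(\<lambda>n. X (r n) * (norm d * B)) \<longlonglongrightarrow> 0 * (norm d * B)"
            using LIMSEQ_subseq_LIMSEQ[OF lim r(1)] by (intro tendsto_intros) (simp add: o_def)
          then have "eventually (\<lambda>n. X (r n) * (norm d * B) < b) sequentially"
            using that by (intro order_tendstoD) auto
          then obtain N where N: "\<And>n. n \<ge> N \<Longrightarrow> X (r n) * (norm d * B) < b"
            by (auto simp: eventually_sequentially)
          have "y \<in> {w. blinfun_apply l w \<le> b}"
          proof (rule y_in[where N = N])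
            show "closed {w. blinfun_apply l w \<le> b}" by (intro closed_Collect_le continuous_intros)
            show "convex {w. blinfun_apply l w \<le> b}"
            proof (rule convexI, clarsimp simp: A_simps)
              fix x y' and a c :: real
              assume *: "blinfun_apply l x \<le> b" "blinfun_apply l y' \<le> b" "0 \<le> a" "0 \<le> c" "a + c = 1"
              then have "a * blinfun_apply l x + c * blinfun_apply l y' \<le> a * b + c * b"
                by (intro add_mono mult_left_mono)
              also have "\<dots> = b" using * by (simp add: distrib_right[symmetric])
              finally show "a * blinfun_apply l x + c * blinfun_apply l y' \<le> b" .
            qed
            show "Y n \<in> {w. blinfun_apply l w \<le> b}" if "n \<ge> N" for n
              using N[OF that] l_q_le[OF X, of "r n"] by (simp add: Y_def)
          qed
          then show ?thesis by simp
        qed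
        then have "blinfun_apply l y \<le> 0" by (rule field_le_epsilon)
        moreover have "y \<in> {w. blinfun_apply l w \<ge> 0}"
        proof (rule y_in[where N = 0])
          show "closed {w. blinfun_apply l w \<ge> 0}" by (intro closed_Collect_le continuous_intros)
          show "convex {w. blinfun_apply l w \<ge> 0}" by (auto simp: convex_def A_simps)
          show "Y n \<in> {w. blinfun_apply l w \<ge> 0}" for n using l_q[OF X] by (simp add: Y_def)
        qed
        ultimately show ?thesis by simp
      qed
      ultimately have "y \<in> C"
        unfolding C_def' using z l_nonneg l_z by (intro polyhedric_V_plus) auto
      from \<eta>(2)[OF this] have "blinfun_apply (A \<eta> - d) (\<eta> - y) \<le> 0" .
      moreover have "y \<in> {w. blinfun_apply (A \<eta> - d) w \<le> blinfun_apply (A \<eta> - d) \<eta> - e}"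
      proof (rule y_in[where N = 0])
        let ?h = "A \<eta> - d" let ?c = "blinfun_apply (A \<eta> - d) \<eta> - e"
        show "closed {w. blinfun_apply ?h w \<le> ?c}" by (intro closed_Collect_le continuous_intros)
        show "convex {w. blinfun_apply ?h w \<le> ?c}"
        proof (rule convexI)
          fix x y' and a c :: real
          assume *: "x \<in> {w. blinfun_apply ?h w \<le> ?c}" "y' \<in> {w. blinfun_apply ?h w \<le> ?c}"
            "0 \<le> a" "0 \<le> c" "a + c = 1"
          then have "a * blinfun_apply ?h x + c * blinfun_apply ?h y' \<le> a * ?c + c * ?c"
            by (intro add_mono mult_left_mono) auto
          also have "\<dots> = ?c" using * by (simp only: distrib_right[symmetric] mult_1)
          finally show "a *\<^sub>R x + c *\<^sub>R y' \<in> {w. blinfun_apply ?h w \<le> ?c}"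
            by (simp only: mem_Collect_eq blinfun.add_right blinfun.scaleR_right real_scaleR_def)
        qed
        show "Y n \<in> {w. blinfun_apply ?h w \<le> ?c}" for n
          using r(2)[of n] by (simp add: Y_def blinfun.diff_right)
      qed
      ultimately show False using \<open>e > 0\<close> by (simp add: blinfun.diff_right)
    qed
    \<comment> \<open>The right-hand side equals the pairing of A(q - \<eta>) with q - \<eta>,
      because \<open>d\<close> cancels.\<close>
    have key: "C\<^sub>a * (norm (q (X i) - \<eta>))\<^sup>2 \<le> blinfun_apply (A (q (X i)) - d) (q (X i) - \<eta>)
        + blinfun_apply (A \<eta> - d) (\<eta> - q (X i))" for i
      using A_coercive[of "q (X i) - \<eta>"]
      by (simp add: linear_diff[OF A_linear] blinfun.diff_left blinfun.diff_right algebra_simps)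
    show "(q \<circ> X) \<longlonglongrightarrow> \<eta>"
    proof (rule tendstoI)
      fix e :: real assume "e > 0"
      then have "C\<^sub>a * e\<^sup>2 / 4 > 0" using C\<^sub>a_pos by simp
      from upper1[OF this] upper2[OF this]
      show "eventually (\<lambda>i. dist ((q \<circ> X) i) \<eta> < e) sequentially"
      proof eventually_elim
        case (elim i)
        then have "C\<^sub>a * (norm (q (X i) - \<eta>))\<^sup>2 \<le> C\<^sub>a * e\<^sup>2 / 2" using key[of i] by linarith
        also have "\<dots> < C\<^sub>a * e\<^sup>2" using \<open>e > 0\<close> C\<^sub>a_pos by simp
        finally have "(norm (q (X i) - \<eta>))\<^sup>2 < e\<^sup>2" using C\<^sub>a_pos by simp
        then show ?case using \<open>e > 0\<close> by (simp add: dist_norm power2_less_imp_less)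
      qed
    qed
  qed
  with \<eta> show ?thesis unfolding q_def by blast
qed

text \<open>The substitution z = \<Phi>(u) - u turns the obstacle problem into the problem on the
  positive cone with source A\<Phi>(u) - f. The derivative \<eta> in direction -e equals -\<delta>;
  reversing both signs in the inequality for \<eta> turns \<eta> - v into \<delta> + v.\<close>

lemma dS_variational_inequality:
  assumes u: "u \<in> Q_set \<xi> \<iota> A \<Phi> f"
    and v: "v \<in> critical_cone (f - A u) (\<Phi> (\<iota> u) - u)"
  shows "blinfun_apply (A (dS \<xi> \<iota> A \<Phi> f u e) - e) (dS \<xi> \<iota> A \<Phi> f u e + v) \<le> 0"
proof -
  define z where "z = \<Phi> (\<iota> u) - u"
  define g where "g = A (\<Phi> (\<iota> u)) - f"
  have Az: "A z - g = f - A u" by (simp add: z_def g_def linear_diff[OF A_linear])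
  have S0: "S0 \<xi> \<iota> A g = z"
  proof (rule S0_eqI)
    show "z \<in> V_plus \<xi> \<iota>"
      using u by (simp add: z_def V_plus_diff_iff Q_set_def K_set_def)
    fix v assume "v \<in> V_plus \<xi> \<iota>"
    then have "\<Phi> (\<iota> u) - (\<Phi> (\<iota> u) - v) \<in> V_plus \<xi> \<iota>" by simp
    then have "\<Phi> (\<iota> u) - v \<in> K_set \<xi> \<iota> \<Phi> (\<iota> u)" unfolding V_plus_diff_iff by (simp add: K_set_def)
    then have "blinfun_apply (A u - f) (u - (\<Phi> (\<iota> u) - v)) \<le> 0" using u by (simp add: Q_set_def)
    then have "blinfun_apply (f - A u) (z - v) \<le> 0"
      by (simp add: z_def blinfun.diff_left blinfun.diff_right)
    then show "blinfun_apply (A z - g) (z - v) \<le> 0" by (simp only: Az)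
  qed
  obtain \<eta> where \<eta>: "\<And>v. v \<in> critical_cone (f - A u) z \<Longrightarrow> blinfun_apply (A \<eta> - (- e)) (\<eta> - v) \<le> 0"
    and lim: "((\<lambda>t. (S0 \<xi> \<iota> A (g + t *\<^sub>R (- e)) - z) /\<^sub>R t) \<longlongrightarrow> \<eta>) (at_right 0)"
    using mignot[of g "- e"] unfolding S0 Az by blast
  have "dS \<xi> \<iota> A \<Phi> f u e = - \<eta>"
    unfolding dS_def S0'_def g_def[symmetric] S0
    using tendsto_Lim[OF _ lim] by simp
  then show ?thesis
    using \<eta>[of v] v by (simp add: z_def linear_neg[OF A_linear] blinfun.diff_left blinfun.diff_right
      blinfun.add_left blinfun.add_right blinfun.minus_left blinfun.minus_right)
qed

end

section \<open>Quasi-continuous representatives\<close>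

context form_domain
begin

text \<open>Carrying a nonnegative witness along with a set of small capacity makes finite unions of such
  sets easy: the witnesses add up.\<close>

definition small_open :: "real \<Rightarrow> 'a set \<Rightarrow> 'v \<Rightarrow> bool" where
  "small_open e U y \<longleftrightarrow> open U \<and> y \<in> V_plus \<xi> \<iota> \<and> norm y < e \<and> (AE x in \<xi>. x \<in> U \<longrightarrow> 1 \<le> \<iota> y x)"

lemma small_open_Un:
  assumes "small_open a U y" "small_open b W z"
  shows "small_open (a + b) (U \<union> W) (y + z)"
proof -
  have "AE x in \<xi>. \<iota> y x \<ge> 0" "AE x in \<xi>. \<iota> z x \<ge> 0"
    "AE x in \<xi>. x \<in> U \<longrightarrow> 1 \<le> \<iota> y x" "AE x in \<xi>. x \<in> W \<longrightarrow> 1 \<le> \<iota> z x"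
    using assms by (auto simp: small_open_def V_plus_def)
  with incl_add[of y z] have "AE x in \<xi>. x \<in> U \<union> W \<longrightarrow> 1 \<le> \<iota> (y + z) x"
    by eventually_elim auto
  moreover have "norm (y + z) < a + b"
    using assms norm_triangle_ineq[of y z] by (auto simp: small_open_def)
  ultimately show ?thesis
    using assms by (auto simp: small_open_def intro: V_plus_add)
qed

text \<open>A competitor for the capacity may be negative away from the neighbourhood. Its positive
  part is still a competitor and costs a factor \<kappa> in norm, hence the bound
  (e/\<kappa>)^2.\<close>

lemma cap_lessD:
  assumes "cap \<xi> \<iota> E < ennreal ((e / \<kappa>)\<^sup>2)" "e > 0"
  shows "\<exists>U y. E \<subseteq> U \<and> small_open e U y"
proof -
  obtain v U where U: "open U" "E \<subseteq> U" "AE x in \<xi>. x \<in> U \<longrightarrow> \<iota> v x \<ge> 1"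
    and v: "ennreal ((norm v)\<^sup>2) < ennreal ((e / \<kappa>)\<^sup>2)"
    using assms(1) unfolding cap_def INF_less_iff by blast
  have "(norm v)\<^sup>2 < (e / \<kappa>)\<^sup>2" using v by (simp add: ennreal_less_iff)
  then have "norm v < e / \<kappa>" by (rule power2_less_imp_less) (use assms(2) kappa_pos in simp)
  then have "\<kappa> * norm v < e" using kappa_pos by (simp add: field_simps)
  then have "norm (pos_part \<xi> \<iota> v) < e" using norm_pos_part_le[of v] by linarith
  moreover have "AE x in \<xi>. x \<in> U \<longrightarrow> 1 \<le> \<iota> (pos_part \<xi> \<iota> v) x"
    using U(3) incl_pos_part[of v] by eventually_elim auto
  ultimately have "small_open e U (pos_part \<xi> \<iota> v)"
    using U(1) pos_part_in_V_plus by (simp add: small_open_def)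
  with U(2) show ?thesis by blast
qed

lemma cap_zeroD: "cap \<xi> \<iota> N = 0 \<Longrightarrow> e > 0 \<Longrightarrow> \<exists>U y. N \<subseteq> U \<and> small_open e U y"
  using kappa_pos by (intro cap_lessD) auto

text \<open>Capacity is expressed by explicit witnesses, so that the exceptional sets of several
  functions can be merged. The square root in the converse is due to capacity being a squared
  norm.\<close>

lemma quasi_continuous_iff:
  "quasi_continuous \<xi> \<iota> w \<longleftrightarrow> (\<forall>e>0. \<exists>U y. small_open e U y \<and> continuous_on (- U) w)"
proof (intro iffI allI impI)
  fix e :: real assume qc: "quasi_continuous \<xi> \<iota> w" and "e > 0"
  then have "(e / \<kappa>)\<^sup>2 > 0" using kappa_pos by simp
  with qc obtain U where U: "cap \<xi> \<iota> U < ennreal ((e / \<kappa>)\<^sup>2)" "continuous_on (- U) w"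
    unfolding quasi_continuous_def by blast
  from cap_lessD[OF U(1) \<open>e > 0\<close>] obtain W y where "U \<subseteq> W" "small_open e W y" by blast
  moreover from this U(2) have "continuous_on (- W) w" by (auto intro: continuous_on_subset)
  ultimately show "\<exists>U y. small_open e U y \<and> continuous_on (- U) w" by blast
next
  assume *: "\<forall>e>0. \<exists>U y. small_open e U y \<and> continuous_on (- U) w"
  show "quasi_continuous \<xi> \<iota> w"
    unfolding quasi_continuous_def
  proof (intro allI impI)
    fix e :: real assume "e > 0"
    then obtain U y where U: "small_open (sqrt e) U y" "continuous_on (- U) w"
      using * by (meson real_sqrt_gt_zero)
    have "cap \<xi> \<iota> U \<le> ennreal ((norm y)\<^sup>2)"
      unfolding cap_def using U(1) by (intro INF_lower) (auto simp: small_open_def)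
    also have "\<dots> < ennreal e"
    proof (rule ennreal_lessI)
      have "(norm y)\<^sup>2 < (sqrt e)\<^sup>2" using U(1) by (intro power_strict_mono) (auto simp: small_open_def)
      then show "(norm y)\<^sup>2 < e" using \<open>e > 0\<close> by simp
    qed (use \<open>e > 0\<close> in simp)
    finally show "\<exists>U. open U \<and> cap \<xi> \<iota> U < ennreal e \<and> continuous_on (- U) w"
      using U by (auto simp: small_open_def)
  qed
qed

lemma quasi_continuous_abs_diff:
  assumes "quasi_continuous \<xi> \<iota> f" "quasi_continuous \<xi> \<iota> g"
  shows "quasi_continuous \<xi> \<iota> (\<lambda>x. \<bar>f x - g x\<bar>)"
  unfolding quasi_continuous_iff
proof (intro allI impI)
  fix e :: real assume "e > 0"
  then have "e / 2 > 0" by simp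
  with assms obtain U y W z where U: "small_open (e / 2) U y" "continuous_on (- U) f"
    and W: "small_open (e / 2) W z" "continuous_on (- W) g"
    unfolding quasi_continuous_iff by meson
  have "small_open e (U \<union> W) (y + z)" using small_open_Un[OF U(1) W(1)] by simp
  moreover have "continuous_on (- (U \<union> W)) (\<lambda>x. \<bar>f x - g x\<bar>)"
    by (intro continuous_intros continuous_on_subset[OF U(2)] continuous_on_subset[OF W(2)]) auto
  ultimately show "\<exists>U y. small_open e U y \<and> continuous_on (- U) (\<lambda>x. \<bar>f x - g x\<bar>)" by blast
qed

text \<open>This takes the place of countable subadditivity of capacity. A cluster point of the
  partial sums inherits every closed convex constraint: the ball of radius \<open>B\<close>, and the
  cones p_n + V_plus.\<close>

lemma V_plus_countable_majorant:
  fixes p :: "nat \<Rightarrow> 'v"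
  assumes p: "\<And>n. p n \<in> V_plus \<xi> \<iota>" and B: "\<And>n. (\<Sum>i<n. norm (p i)) \<le> B"
  shows "\<exists>y. norm y \<le> B \<and> (\<forall>n. y - p n \<in> V_plus \<xi> \<iota>)"
proof -
  define S where "S n = (\<Sum>i<n. p i)" for n
  have S_B: "norm (S n) \<le> B" for n
    unfolding S_def using norm_sum B by (rule order_trans)
  then have "bounded (range S)" by (auto simp: bounded_iff)
  from bounded_seq_convex_cluster_point[OF this]
  obtain y where y: "\<And>n. y \<in> closure (convex hull (S ` {n..}))" by blast
  have y_in: "y \<in> T" if "closed T" "convex T" "\<And>n. n \<ge> N \<Longrightarrow> S n \<in> T" for T N
  proof -
    have "closure (convex hull (S ` {N..})) \<subseteq> T"
      using that by (intro closure_minimal hull_minimal) auto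
    with y show ?thesis by blast
  qed
  have "y \<in> cball 0 B" using S_B by (intro y_in[where N = 0]) auto
  moreover have "y - p n \<in> V_plus \<xi> \<iota>" for n
  proof -
    have "y \<in> (+) (p n) ` V_plus \<xi> \<iota>"
    \<comment> \<open>\<open>S m\<close> sums the indices below \<open>m\<close>, so
      \<open>p n\<close> is a summand only from \<open>Suc n\<close> on.\<close>
    proof (rule y_in[where N = "Suc n"])
      show "closed ((+) (p n) ` V_plus \<xi> \<iota>)" by (rule closed_translation[OF closed_V_plus])
      show "convex ((+) (p n) ` V_plus \<xi> \<iota>)" by (rule convex_translation[OF convex_V_plus])
      fix m assume "m \<ge> Suc n"
      then have "S m = p n + (\<Sum>i\<in>{..<m} - {n}. p i)"
        unfolding S_def by (intro sum.remove) auto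
      moreover have "(\<Sum>i\<in>F. p i) \<in> V_plus \<xi> \<iota>" if "finite F" for F
        using that by induction (auto intro: V_plus_add zero_in_V_plus p)
      ultimately show "S m \<in> (+) (p n) ` V_plus \<xi> \<iota>" by auto
    qed
    then show ?thesis by auto
  qed
  ultimately show ?thesis by auto
qed

lemma V_limit_AE_subseq:
  assumes "s \<longlonglongrightarrow> v"
  shows "\<exists>r::nat\<Rightarrow>nat. strict_mono r \<and> (AE x in \<xi>. (\<lambda>n. \<iota> (s (r n)) x) \<longlonglongrightarrow> \<iota> v x)"
proof -
  have "(\<lambda>n. L2_sq (s n - v)) \<longlonglongrightarrow> 0" using L2_sq_tendsto_0[OF assms, of 1] by simp
  then have "(\<lambda>n. \<integral>x. norm ((\<iota> (s n - v) x)\<^sup>2) \<partial>\<xi>) \<longlonglongrightarrow> 0" by (simp add: L2_sq_def)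
  from tendsto_L1_AE_subseq[OF incl_integrable_sq this]
  obtain r :: "nat \<Rightarrow> nat" where r: "strict_mono r" and ae: "AE x in \<xi>. (\<lambda>n. (\<iota> (s (r n) - v) x)\<^sup>2) \<longlonglongrightarrow> 0" by blast
  have "AE x in \<xi>. \<forall>n. \<iota> (s (r n) - v) x = \<iota> (s (r n)) x - \<iota> v x"
    unfolding AE_all_countable using incl_diff by blast
  with ae have "AE x in \<xi>. (\<lambda>n. \<iota> (s (r n)) x) \<longlonglongrightarrow> \<iota> v x"
  proof eventually_elim
    case (elim x)
    then have "(\<lambda>n. sqrt ((\<iota> (s (r n)) x - \<iota> v x)\<^sup>2)) \<longlonglongrightarrow> sqrt 0" by (intro tendsto_real_sqrt) simp
    then have "(\<lambda>n. \<iota> (s (r n)) x - \<iota> v x) \<longlonglongrightarrow> 0" by (simp add: tendsto_rabs_zero_iff)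
    then show ?case by (simp add: LIM_zero_iff)
  qed
  with r show ?thesis by blast
qed

text \<open>Continuous functions \<phi>_n approximate v so fast in V that they converge uniformly
  outside the sets \<open>W N\<close>, which have witnesses of norm tending to 0. Their pointwise
  limit is the representative.\<close>

lemma quasi_continuous_representative:
  "\<exists>w. quasi_continuous \<xi> \<iota> w \<and> (AE x in \<xi>. w x = \<iota> v x)"
proof -
  \<comment> \<open>The rate 1/8 pays for the weight 2^n in \<open>p\<close> and still leaves
    4^{-n}; the later sum uses one factor 2^{-n} of it and bounds the other by 1.\<close>
  have "\<exists>w \<phi>. \<phi> \<in> C_c \<and> (AE x in \<xi>. \<iota> w x = \<phi> x) \<and> norm (v - w) < (1/8) ^ n" for n :: nat
    using dense_V[of "(1/8) ^ n" v] by auto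
  then obtain w \<phi> where \<phi>: "\<phi> n \<in> C_c" "AE x in \<xi>. \<iota> (w n) x = \<phi> n x" "norm (v - w n) < (1/8) ^ n" for n :: nat
    by metis
  \<comment> \<open>The weighted modulus 2^n |w_{n+1} - w_n|: a Chebyshev-type majorant, at least 1
    wherever \<phi>_n and \<phi>_{n+1} differ by more than 2^{-n}.\<close>
  define p where "p n = 2 ^ n *\<^sub>R (pos_part \<xi> \<iota> (w (Suc n) - w n) + pos_part \<xi> \<iota> (- (w (Suc n) - w n)))" for n
  have p_V: "p n \<in> V_plus \<xi> \<iota>" for n
    unfolding p_def by (intro V_plus_scaleR V_plus_add pos_part_in_V_plus) simp
  have p_norm: "norm (p n) \<le> 4 * \<kappa> * (1/2) ^ n * (1/2) ^ n" for n
  proof -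
    have "norm (w (Suc n) - w n) \<le> norm (v - w n) + norm (v - w (Suc n))"
      using norm_triangle_ineq4[of "v - w n" "v - w (Suc n)"] by simp
    also have "\<dots> \<le> (1/8) ^ n + (1/8) ^ Suc n"
      using \<phi>(3)[of n] \<phi>(3)[of "Suc n"] by linarith
    also have "\<dots> \<le> 2 * (1/8) ^ n" by simp
    finally have e: "norm (w (Suc n) - w n) \<le> 2 * (1/8) ^ n" .
    have "norm (pos_part \<xi> \<iota> (w (Suc n) - w n) + pos_part \<xi> \<iota> (- (w (Suc n) - w n)))
        \<le> \<kappa> * norm (w (Suc n) - w n) + \<kappa> * norm (- (w (Suc n) - w n))"
      by (intro norm_triangle_le add_mono norm_pos_part_le)
    also have "\<dots> = 2 * \<kappa> * norm (w (Suc n) - w n)" unfolding norm_minus_cancel by simp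
    also have "\<dots> \<le> 2 * \<kappa> * (2 * (1/8) ^ n)"
      using e kappa_pos by (intro mult_left_mono) auto
    finally have "norm (p n) \<le> 2 ^ n * (2 * \<kappa> * (2 * (1/8) ^ n))"
      unfolding p_def norm_scaleR by (intro mult_mono) auto
    also have "\<dots> = 4 * \<kappa> * (1/2) ^ n * (1/2) ^ n"
    proof -
      have "(2::real) ^ n * (1/8) ^ n = (1/2) ^ n * (1/2) ^ n"
        unfolding power_mult_distrib[symmetric] by simp
      then show ?thesis by (simp add: mult.assoc mult.left_commute[of _ "2 ^ n"] mult.commute)
    qed
    finally show ?thesis .
  qed
  define W where "W N = (\<Union>n\<in>{N..}. {x. (1/2) ^ n < \<bar>\<phi> (Suc n) x - \<phi> n x\<bar>})" for N
  have open_W: "open (W N)" for N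
    unfolding W_def using \<phi>(1)
    by (intro open_UN ballI open_Collect_less continuous_intros) (auto simp: C_c_def)
  have p_ge: "AE x in \<xi>. \<forall>n. (1/2) ^ n < \<bar>\<phi> (Suc n) x - \<phi> n x\<bar> \<longrightarrow> 1 \<le> \<iota> (p n) x"
    unfolding AE_all_countable
  proof
    fix n
    let ?d = "w (Suc n) - w n"
    show "AE x in \<xi>. (1/2) ^ n < \<bar>\<phi> (Suc n) x - \<phi> n x\<bar> \<longrightarrow> 1 \<le> \<iota> (p n) x"
      using \<phi>(2)[of n] \<phi>(2)[of "Suc n"] incl_diff[of "w (Suc n)" "w n"] incl_pos_part[of ?d]
        incl_pos_part[of "- ?d"] incl_minus[of ?d] incl_add[of "pos_part \<xi> \<iota> ?d" "pos_part \<xi> \<iota> (- ?d)"]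
        incl_scaleR[of "2 ^ n" "pos_part \<xi> \<iota> ?d + pos_part \<xi> \<iota> (- ?d)"]
    proof eventually_elim
      case (elim x)
      have "\<iota> (pos_part \<xi> \<iota> ?d + pos_part \<xi> \<iota> (- ?d)) x = \<bar>\<phi> (Suc n) x - \<phi> n x\<bar>"
        using elim by (simp only:)
      then have "\<iota> (p n) x = 2 ^ n * \<bar>\<phi> (Suc n) x - \<phi> n x\<bar>" using elim by (simp add: p_def)
      then show ?case by (auto simp: field_simps power_divide)
    qed
  qed
  have "\<exists>y. norm y \<le> 8 * \<kappa> * (1/2) ^ N \<and> (\<forall>n. y - p (N + n) \<in> V_plus \<xi> \<iota>)" for N
  proof (rule V_plus_countable_majorant)
    show "p (N + n) \<in> V_plus \<xi> \<iota>" for n by (rule p_V)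
    fix n
    have "norm (p (N + i)) \<le> 4 * \<kappa> * (1/2) ^ N * (1/2) ^ i" for i
    proof -
      have "(1/2::real) ^ (N + i) * (1/2) ^ (N + i) \<le> (1/2) ^ (N + i) * 1"
        by (intro mult_left_mono power_le_one) auto
      then have "4 * \<kappa> * ((1/2) ^ (N + i) * (1/2) ^ (N + i)) \<le> 4 * \<kappa> * (1/2) ^ (N + i)"
        using kappa_pos by (intro mult_left_mono) auto
      with p_norm[of "N + i"] show ?thesis by (simp add: power_add mult.assoc)
    qed
    then have "(\<Sum>i<n. norm (p (N + i))) \<le> (\<Sum>i<n. 4 * \<kappa> * (1/2) ^ N * (1/2) ^ i)"
      by (intro sum_mono)
    also have "\<dots> = 4 * \<kappa> * (1/2) ^ N * (\<Sum>i<n. (1/2) ^ i)" by (simp add: sum_distrib_left)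
    also have "(\<Sum>i<n. (1/2::real) ^ i) = 2 - 2 * (1/2) ^ n" by (induction n) auto
    also have "4 * \<kappa> * (1/2) ^ N * (2 - 2 * (1/2) ^ n) \<le> 4 * \<kappa> * (1/2) ^ N * 2"
      using kappa_pos by (intro mult_left_mono) auto
    finally show "(\<Sum>i<n. norm (p (N + i))) \<le> 8 * \<kappa> * (1/2) ^ N" by simp
  qed
  then obtain y where y_norm: "norm (y N) \<le> 8 * \<kappa> * (1/2) ^ N"
    and y_ge: "y N - p (N + n) \<in> V_plus \<xi> \<iota>" for N n by metis
  have y_V: "y N \<in> V_plus \<xi> \<iota>" for N
    using V_plus_add[OF y_ge[of N 0] p_V[of N]] by simp
  have y_W: "AE x in \<xi>. x \<in> W N \<longrightarrow> 1 \<le> \<iota> (y N) x" for N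
  proof -
    have "AE x in \<xi>. \<forall>n. \<iota> (p (N + n)) x \<le> \<iota> (y N) x"
      unfolding AE_all_countable V_plus_diff_iff[symmetric] using y_ge by blast
    with p_ge show ?thesis
    proof eventually_elim
      case (elim x)
      show ?case
      proof
        assume "x \<in> W N"
        then obtain n where "n \<ge> N" "(1/2) ^ n < \<bar>\<phi> (Suc n) x - \<phi> n x\<bar>" by (auto simp: W_def)
        with elim have "1 \<le> \<iota> (p n) x" by blast
        also have "\<dots> \<le> \<iota> (y N) x" using elim(2) \<open>n \<ge> N\<close> by (metis le_iff_add)
        finally show "1 \<le> \<iota> (y N) x" .
      qed
    qed
  qed
  have y_lim: "y \<longlonglongrightarrow> 0"
  proof (rule tendsto_norm_zero_cancel, rule tendsto_sandwich[OF _ _ tendsto_const])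
    show "(\<lambda>N. 8 * \<kappa> * (1/2) ^ N) \<longlonglongrightarrow> 0"
      by (intro tendsto_mult_right_zero LIMSEQ_power_zero) simp
  qed (use y_norm in auto)
  \<comment> \<open>\<open>lim\<close> is unspecified where the sequence diverges; such points lie
    in every \<open>W N\<close>, and a.e. point escapes some \<open>W N\<close>.\<close>
  define g where "g x = lim (\<lambda>n. \<phi> n x)" for x
  have step: "\<bar>\<phi> (n + k) x - \<phi> n x\<bar> \<le> 2 * (1/2) ^ n" if "x \<notin> W N" "n \<ge> N" for x n k N
  proof -
    have "\<bar>\<phi> (n + k) x - \<phi> n x\<bar> \<le> 2 * (1/2) ^ n - 2 * (1/2) ^ (n + k)"
    proof (induction k)
      case (Suc k)
      have "\<bar>\<phi> (Suc (n + k)) x - \<phi> (n + k) x\<bar> \<le> (1/2) ^ (n + k)"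
        using that by (auto simp: W_def not_less)
      with Suc show ?case by simp
    qed simp
    also have "\<dots> \<le> 2 * (1/2) ^ n" by simp
    finally show ?thesis .
  qed
  have \<phi>_lim: "(\<lambda>n. \<phi> n x) \<longlonglongrightarrow> g x" if "x \<notin> W N" for x N
  proof -
    have "Cauchy (\<lambda>n. \<phi> n x)"
      unfolding Cauchy_altdef
    proof (intro allI impI)
      fix e :: real assume "e > 0"
      have "(\<lambda>n. 2 * (1/2::real) ^ n) \<longlonglongrightarrow> 0"
        by (intro tendsto_mult_right_zero LIMSEQ_power_zero) simp
      then have "eventually (\<lambda>n. 2 * (1/2::real) ^ n < e) sequentially"
        using \<open>e > 0\<close> by (rule order_tendstoD)
      then obtain M where M: "\<And>n. n \<ge> M \<Longrightarrow> 2 * (1/2::real) ^ n < e"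
        by (auto simp: eventually_sequentially)
      have "dist (\<phi> m x) (\<phi> n x) < e" if "m \<ge> max M N" "n > m" for m n
        using step[OF \<open>x \<notin> W N\<close>, of m "n - m"] M[of m] that by (simp add: dist_real_def abs_minus_commute)
      then show "\<exists>M. \<forall>m\<ge>M. \<forall>n>m. dist (\<phi> m x) (\<phi> n x) < e" by blast
    qed
    then show ?thesis unfolding g_def by (simp add: Cauchy_convergent_iff convergent_LIMSEQ_iff)
  qed
  have g_close: "\<bar>g x - \<phi> n x\<bar> \<le> 2 * (1/2) ^ n" if "x \<notin> W N" "n \<ge> N" for x n N
  proof (rule tendsto_upperbound)
    show "(\<lambda>k. \<bar>\<phi> (k + n) x - \<phi> n x\<bar>) \<longlonglongrightarrow> \<bar>g x - \<phi> n x\<bar>"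
      using \<phi>_lim[OF that(1)] by (intro tendsto_intros LIMSEQ_ignore_initial_segment)
    show "eventually (\<lambda>k. \<bar>\<phi> (k + n) x - \<phi> n x\<bar> \<le> 2 * (1/2) ^ n) sequentially"
      using step[OF that] by (auto simp: add.commute)
  qed simp
  have "quasi_continuous \<xi> \<iota> g"
    unfolding quasi_continuous_iff
  proof (intro allI impI)
    fix e :: real assume "e > 0"
    from y_lim have "(\<lambda>N. norm (y N)) \<longlonglongrightarrow> 0" by (rule tendsto_norm_zero)
    then have "eventually (\<lambda>N. norm (y N) < e) sequentially" using \<open>e > 0\<close> by (rule order_tendstoD)
    then obtain N where N: "norm (y N) < e" by (auto simp: eventually_sequentially)
    have "small_open e (W N) (y N)" using N open_W y_V y_W by (simp add: small_open_def)
    moreover have "continuous_on (- W N) g"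
    proof (rule uniform_limit_theorem[where F = sequentially])
      show "\<forall>\<^sub>F n in sequentially. continuous_on (- W N) (\<phi> n)"
        using \<phi>(1) by (intro always_eventually allI) (auto simp: C_c_def intro: continuous_on_subset)
      show "uniform_limit (- W N) \<phi> g sequentially"
      proof (rule uniform_limitI)
        fix b :: real assume "b > 0"
        have "(\<lambda>n. 2 * (1/2::real) ^ n) \<longlonglongrightarrow> 0"
          by (intro tendsto_mult_right_zero LIMSEQ_power_zero) simp
        then have "eventually (\<lambda>n. 2 * (1/2::real) ^ n < b) sequentially"
          using \<open>b > 0\<close> by (rule order_tendstoD)
        then show "\<forall>\<^sub>F n in sequentially. \<forall>x\<in>- W N. dist (\<phi> n x) (g x) < b"
          using eventually_ge_at_top[of N]
        proof eventually_elim
          case (elim n)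
          then show ?case
            using g_close[of _ N n] by (auto simp: dist_real_def abs_minus_commute intro: le_less_trans)
        qed
      qed
    qed simp
    ultimately show "\<exists>U y. small_open e U y \<and> continuous_on (- U) g" by blast
  qed
  moreover have "AE x in \<xi>. g x = \<iota> v x"
  proof -
    have "w \<longlonglongrightarrow> v"
    proof (rule LIM_zero_cancel, rule tendsto_norm_zero_cancel, rule tendsto_sandwich[OF _ _ tendsto_const])
      show "(\<lambda>n. (1/8::real) ^ n) \<longlonglongrightarrow> 0" by (intro LIMSEQ_power_zero) simp
    qed (use less_imp_le[OF \<phi>(3)] in \<open>auto simp: norm_minus_commute intro!: always_eventually\<close>)
    then obtain r :: "nat \<Rightarrow> nat" where r: "strict_mono r" "AE x in \<xi>. (\<lambda>n. \<iota> (w (r n)) x) \<longlonglongrightarrow> \<iota> v x"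
      using V_limit_AE_subseq by blast
    \<comment> \<open>The witnesses tend to 0 a.e. along a subsequence, so at a.e. point some
      witness is below 1 and the point lies outside the corresponding \<open>W N\<close>.\<close>
    obtain s :: "nat \<Rightarrow> nat" where s: "AE x in \<xi>. (\<lambda>n. \<iota> (y (s n)) x) \<longlonglongrightarrow> \<iota> 0 x"
      using V_limit_AE_subseq[OF y_lim] by blast
    have "AE x in \<xi>. \<forall>n. \<iota> (w n) x = \<phi> n x" "AE x in \<xi>. \<forall>N. x \<in> W N \<longrightarrow> 1 \<le> \<iota> (y N) x"
      unfolding AE_all_countable using \<phi>(2) y_W by auto
    with r(2) s incl_zero show ?thesis
    proof eventually_elim
      case (elim x)
      have "(\<lambda>n. \<iota> (y (s n)) x) \<longlonglongrightarrow> 0" using elim(2,3) by simp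
      then have "eventually (\<lambda>n. \<iota> (y (s n)) x < 1) sequentially" by (rule order_tendstoD) simp
      then obtain n where "\<iota> (y (s n)) x < 1" by (auto simp: eventually_sequentially)
      then have "x \<notin> W (s n)" using elim(5) by (meson not_less)
      then have "(\<lambda>n. \<phi> (r n) x) \<longlonglongrightarrow> g x"
        using LIMSEQ_subseq_LIMSEQ[OF \<phi>_lim r(1)] by (simp add: o_def)
      moreover have "(\<lambda>n. \<phi> (r n) x) \<longlonglongrightarrow> \<iota> v x" using elim(1,4) by simp
      ultimately show ?case by (rule LIMSEQ_unique)
    qed
  qed
  ultimately show ?thesis by blast
qed

lemma qc_rep:
  shows qc_rep_quasi_continuous: "quasi_continuous \<xi> \<iota> (qc_rep \<xi> \<iota> v)"
    and qc_rep_AE: "AE x in \<xi>. qc_rep \<xi> \<iota> v x = \<iota> v x"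
  using someI_ex[OF quasi_continuous_representative[of v]] unfolding qc_rep_def by auto

end

section \<open>The tangent cone of the positive cone\<close>

context form_domain
begin

text \<open>A compactly supported Urysohn function equal to 2 on \<open>K\<close> is approximated
  uniformly within 1 by an element of V; the value 2 leaves room for that error.\<close>

lemma compact_majorant:
  assumes "compact K"
  shows "\<exists>\<psi>\<in>V_plus \<xi> \<iota>. AE x in \<xi>. x \<in> K \<longrightarrow> 1 \<le> \<iota> \<psi> x"
proof -
  have haus: "Hausdorff_space (euclidean :: 'a topology)"
    unfolding Hausdorff_space_def disjnt_def by (simp add: Int_commute) (metis hausdorff)
  obtain U L where UL: "open U" "compact L" "closed L" "K \<subseteq> U" "U \<subseteq> L"
    using locally_compact assms haus
    unfolding locally_compact_space_compact_closed_compact[OF disjI1[OF haus]] by auto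
  have "completely_regular_space (euclidean :: 'a topology)"
    using locally_compact_regular_imp_completely_regular_space locally_compact haus by blast
  then obtain h where h: "continuous_map euclidean euclideanreal h" "h ` (- U) \<subseteq> {0}" "h ` K \<subseteq> {2}"
    using Urysohn_completely_regular_compact_closed_alt[of "euclidean :: 'a topology" K "- U" 0 2]
      assms UL(1,4) by (auto simp: disjnt_def)
  have "{x. h x \<noteq> 0} \<subseteq> L" using h(2) UL(5) by auto
  then have "closure {x. h x \<noteq> 0} \<subseteq> L" using UL(3) by (rule closure_minimal)
  then have "compact (closure {x. h x \<noteq> 0})" using UL(2) by (metis closed_closure compact_Int_closed inf.absorb2)
  then have "h \<in> C_c" using h(1) by (simp add: C_c_def)
  then obtain v \<phi> where v: "AE x in \<xi>. \<iota> v x = \<phi> x" "\<forall>x. \<bar>h x - \<phi> x\<bar> < 1"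
    using dense_C_c[of h 1] by auto
  have "1 \<le> \<phi> x" if "x \<in> K" for x
    using h(3) that v(2)[rule_format, of x] by auto
  then have \<phi>_ge: "x \<in> K \<longrightarrow> 1 \<le> \<phi> x" for x by blast
  have "AE x in \<xi>. x \<in> K \<longrightarrow> 1 \<le> \<iota> (pos_part \<xi> \<iota> v) x"
    using v(1) incl_pos_part[of v]
  proof eventually_elim
    case (elim x)
    then show ?case using \<phi>_ge[of x] by (auto simp: max_def)
  qed
  then show ?thesis using pos_part_in_V_plus by blast
qed

text \<open>The Dini argument needs compactness and boundedness, so p is first cut down to min(p,
  w^+) with w represented in C_c. The rest (p - w^+)^+ is at most (p - w)^+, which is small in V.
  The error \<open>e\<close> is split into thirds, for this rest, for \<eta>\<psi>, and for M y; the
  multiple of z contributes nothing.\<close>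

lemma positive_functional_bound:
  fixes h :: "'v \<Rightarrow>\<^sub>L real"
  assumes z: "z \<in> V_plus \<xi> \<iota>"
    and h_nonneg: "\<And>w. w \<in> V_plus \<xi> \<iota> \<Longrightarrow> blinfun_apply h w \<ge> 0"
    and h_z: "blinfun_apply h z = 0"
    and zq: "quasi_continuous \<xi> \<iota> zq" "AE x in \<xi>. zq x = \<iota> z x" "\<And>x. zq x \<ge> 0"
    and pq: "quasi_continuous \<xi> \<iota> pq" "AE x in \<xi>. pq x = \<iota> p x"
    and qe: "quasi_everywhere \<xi> \<iota> (\<lambda>x. zq x = 0 \<longrightarrow> pq x \<le> 0)"
  shows "blinfun_apply h p \<le> 0"
proof -
  let ?P = "pos_part \<xi> \<iota>"
  have h_mono: "blinfun_apply h a \<le> blinfun_apply h b" if "AE x in \<xi>. \<iota> a x \<le> \<iota> b x" for a b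
    using h_nonneg[of "b - a"] that by (simp add: V_plus_diff_iff blinfun.diff_right)
  have h_norm: "blinfun_apply h a \<le> norm h * norm a" for a
    using norm_blinfun[of h a] by simp
  have "blinfun_apply h p \<le> 0 + e" if "e > 0" for e
  proof -
    define H where "H = norm h + 1"
    have H: "H > 0" "norm h \<le> H" by (simp_all add: H_def add_nonneg_pos)
    have "e / (3 * H * \<kappa>) > 0" using \<open>e > 0\<close> H kappa_pos by simp
    then obtain w \<phi> where \<phi>: "\<phi> \<in> C_c" "AE x in \<xi>. \<iota> w x = \<phi> x" and w: "norm (p - w) < e / (3 * H * \<kappa>)"
      using dense_V by blast
    define K where "K = closure {x. \<phi> x \<noteq> 0}"
    have K: "compact K" "closed K" using \<phi>(1) by (auto simp: C_c_def K_def)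
    have \<phi>_outside: "\<phi> x = 0" if "x \<notin> K" for x
      using that closure_subset[of "{x. \<phi> x \<noteq> 0}"] by (auto simp: K_def)
    have "compact (\<phi> ` K)"
      using \<phi>(1) K(1) by (intro compact_continuous_image) (auto simp: C_c_def intro: continuous_on_subset)
    then obtain M0 where M0: "\<And>x. x \<in> K \<Longrightarrow> \<bar>\<phi> x\<bar> \<le> M0"
      by (auto dest!: compact_imp_bounded simp: bounded_iff) blast
    define M where "M = \<bar>M0\<bar> + 1"
    have M: "M > 0" "\<phi> x \<le> M" for x
      using M0[of x] \<phi>_outside[of x] by (cases "x \<in> K"; force simp: M_def)+
    obtain \<psi> where \<psi>: "\<psi> \<in> V_plus \<xi> \<iota>" "AE x in \<xi>. x \<in> K \<longrightarrow> 1 \<le> \<iota> \<psi> x"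
      using compact_majorant[OF K(1)] by blast
    define \<eta> where "\<eta> = e / (3 * (blinfun_apply h \<psi> + 1))"
    have h\<psi>: "blinfun_apply h \<psi> \<ge> 0" by (rule h_nonneg[OF \<psi>(1)])
    have \<eta>: "\<eta> > 0" using h\<psi> \<open>e > 0\<close> by (simp add: \<eta>_def)
    \<comment> \<open>The outer third is there because three exceptional sets are united: one for
      each of \<open>zq\<close> and \<open>pq\<close>, and one covering the capacity-zero set
      \<open>N\<close>.\<close>
    define r where "r = e / (3 * H * M) / 3"
    have r: "r > 0" using \<open>e > 0\<close> H M by (simp add: r_def)
    obtain U1 y1 where 1: "small_open r U1 y1" "continuous_on (- U1) zq"
      using zq(1) r unfolding quasi_continuous_iff by blast
    obtain U2 y2 where 2: "small_open r U2 y2" "continuous_on (- U2) pq"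
      using pq(1) r unfolding quasi_continuous_iff by blast
    obtain N where N: "cap \<xi> \<iota> N = 0" "\<And>x. x \<notin> N \<Longrightarrow> zq x = 0 \<longrightarrow> pq x \<le> 0"
      using qe unfolding quasi_everywhere_def by blast
    obtain U3 y3 where 3: "N \<subseteq> U3" "small_open r U3 y3"
      using cap_zeroD[OF N(1) r] by blast
    define U where "U = U1 \<union> U2 \<union> U3"
    define y where "y = y1 + y2 + y3"
    have U: "small_open (e / (3 * H * M)) U y"
    proof -
      have "r + r + r = e / (3 * H * M)" by (simp add: r_def)
      then show ?thesis
        using small_open_Un[OF small_open_Un[OF 1(1) 2(1)] 3(2)] by (simp only: U_def y_def)
    qed
    \<comment> \<open>Closed subsets of the compact \<open>K\<close>, decreasing in \<open>n\<close>
      since \<open>zq\<close> \<ge> 0. A common point would have \<open>zq\<close> = 0 by the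
      Archimedean property, but \<open>pq\<close> \<ge> \<eta> > 0, which the q.e. hypothesis
      excludes outside \<open>N\<close>.\<close>
    define F where "F n = {x \<in> K - U. real n * zq x + \<eta> \<le> pq x}" for n :: nat
    have "\<exists>n. F n = {}"
    proof (rule ccontr)
      assume "\<nexists>n. F n = {}"
      then have ne: "F n \<noteq> {}" for n by blast
      have closedKU: "closed (K - U)" using K(2) U by (auto simp: small_open_def)
      have "closed (F n)" for n
        unfolding F_def
        by (intro continuous_on_closed_Collect_le closedKU continuous_intros
            continuous_on_subset[OF 1(2)] continuous_on_subset[OF 2(2)]) (auto simp: U_def)
      moreover have "K \<inter> (\<Inter>n\<in>I. F n) \<noteq> {}" if "finite I" for I
      proof -
        have "F (Max (insert 0 I)) \<subseteq> F n" if "n \<in> I" for n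
        proof
          fix x assume "x \<in> F (Max (insert 0 I))"
          moreover have "real n * zq x \<le> real (Max (insert 0 I)) * zq x"
            using \<open>finite I\<close> that zq(3)[of x] by (intro mult_right_mono) auto
          ultimately show "x \<in> F n" by (auto simp: F_def)
        qed
        moreover have "F (Max (insert 0 I)) \<subseteq> K" by (auto simp: F_def)
        ultimately show ?thesis using ne[of "Max (insert 0 I)"] by blast
      qed
      ultimately have "K \<inter> (\<Inter>n\<in>UNIV. F n) \<noteq> {}"
        by (rule compact_imp_fip_image[OF K(1)])
      then obtain x where x: "\<And>n. x \<in> F n" by blast
      then have le: "real n * zq x + \<eta> \<le> pq x" for n by (auto simp: F_def)
      show False
      proof (cases "zq x = 0")
        case True
        have "x \<notin> N" using x[of 0] 3(1) by (auto simp: F_def U_def)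
        with N(2) True have "pq x \<le> 0" by blast
        with le[of 0] \<eta> show False by simp
      next
        case False
        then have "zq x > 0" using zq(3)[of x] by simp
        then obtain n where "pq x < real n * zq x" using reals_Archimedean3 by blast
        with le[of n] \<eta> show False by simp
      qed
    qed
    then obtain n where n: "F n = {}" by blast
    let ?b = "real n *\<^sub>R z + \<eta> *\<^sub>R \<psi> + M *\<^sub>R y"
    have "AE x in \<xi>. \<iota> z x \<ge> 0" "AE x in \<xi>. \<iota> \<psi> x \<ge> 0" "AE x in \<xi>. \<iota> y x \<ge> 0"
      "AE x in \<xi>. x \<in> U \<longrightarrow> 1 \<le> \<iota> y x"
      using z \<psi>(1) U by (auto simp: V_plus_def small_open_def)
    then have "AE x in \<xi>. \<iota> (vmin p (?P w)) x \<le> \<iota> ?b x"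
      using zq(2) pq(2) \<phi>(2) \<psi>(2) incl_vmin[of p "?P w"] incl_pos_part[of w]
        incl_add[of "real n *\<^sub>R z + \<eta> *\<^sub>R \<psi>" "M *\<^sub>R y"] incl_add[of "real n *\<^sub>R z" "\<eta> *\<^sub>R \<psi>"]
        incl_scaleR[of "real n" z] incl_scaleR[of \<eta> \<psi>] incl_scaleR[of M y]
    proof eventually_elim
      case (elim x)
      have b: "\<iota> ?b x = real n * zq x + \<eta> * \<iota> \<psi> x + M * \<iota> y x" using elim by simp
      have terms: "0 \<le> real n * zq x" "0 \<le> \<eta> * \<iota> \<psi> x" "0 \<le> M * \<iota> y x"
        using zq(3)[of x] \<eta> M(1) elim(2,3) by auto
      have min: "\<iota> (vmin p (?P w)) x = min (pq x) (max (\<phi> x) 0)" using elim by simp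
      \<comment> \<open>Off \<open>K\<close> the truncation is at most 0, on \<open>U\<close> the
        term M y dominates it, and on the remainder the emptiness of \<open>F n\<close> bounds it,
        with \<psi> \<ge> 1 supplying the summand \<eta>.\<close>
      consider "x \<notin> K" | "x \<in> U" | "x \<in> K - U" by blast
      then show ?case
      proof cases
        case 1
        then show ?thesis using terms b min \<phi>_outside[of x] by simp
      next
        case 2
        then have "M * 1 \<le> M * \<iota> y x" using elim(4) M(1) by (intro mult_left_mono) auto
        moreover have "\<iota> (vmin p (?P w)) x \<le> M" using min M(1) M(2)[of x] by simp
        ultimately show ?thesis using terms b by linarith
      next
        case 3
        then have "pq x < real n * zq x + \<eta>" using n by (auto simp: F_def not_le)
        moreover have "\<eta> * 1 \<le> \<eta> * \<iota> \<psi> x" using 3 elim(8) \<eta> by (intro mult_left_mono) auto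
        ultimately show ?thesis using terms b min by (auto simp: min_def)
      qed
    qed
    then have "blinfun_apply h (vmin p (?P w)) \<le> blinfun_apply h ?b" by (rule h_mono)
    also have "\<dots> = \<eta> * blinfun_apply h \<psi> + M * blinfun_apply h y"
      by (simp add: blinfun.add_right blinfun.scaleR_right h_z)
    also have "\<dots> \<le> e / 3 + e / 3"
    proof (rule add_mono)
      show "\<eta> * blinfun_apply h \<psi> \<le> e / 3"
        using h\<psi> \<open>e > 0\<close> by (simp add: \<eta>_def field_simps)
      have "blinfun_apply h y \<le> H * norm y"
        using h_norm[of y] mult_right_mono[OF H(2), of "norm y"] by simp
      also have "\<dots> \<le> H * (e / (3 * H * M))"
        using U H by (intro mult_left_mono) (auto simp: small_open_def)
      also have "\<dots> = e / (3 * M)" using H by simp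
      finally have "M * blinfun_apply h y \<le> M * (e / (3 * M))" using M(1) by (intro mult_left_mono) auto
      then show "M * blinfun_apply h y \<le> e / 3" using M(1) by simp
    qed
    finally have 1: "blinfun_apply h (vmin p (?P w)) \<le> e / 3 + e / 3" .
    have "AE x in \<xi>. \<iota> (?P (p - ?P w)) x \<le> \<iota> (?P (p - w)) x"
      using incl_pos_part[of "p - ?P w"] incl_pos_part[of "p - w"] incl_pos_part[of w]
        incl_diff[of p "?P w"] incl_diff[of p w]
      by eventually_elim auto
    then have "blinfun_apply h (?P (p - ?P w)) \<le> blinfun_apply h (?P (p - w))" by (rule h_mono)
    also have "\<dots> \<le> norm h * norm (?P (p - w))" by (rule h_norm)
    also have "\<dots> \<le> H * (\<kappa> * norm (p - w))"
      using H norm_pos_part_le by (intro mult_mono) auto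
    also have "\<dots> \<le> H * (\<kappa> * (e / (3 * H * \<kappa>)))"
      using w H kappa_pos by (intro mult_left_mono) auto
    also have "\<dots> = e / 3" using H kappa_pos by simp
    finally have "blinfun_apply h (?P (p - ?P w)) \<le> e / 3" .
    moreover have "blinfun_apply h p = blinfun_apply h (vmin p (?P w)) + blinfun_apply h (?P (p - ?P w))"
      unfolding vmin_def by (simp add: blinfun.diff_right)
    ultimately show ?thesis using 1 by simp
  qed
  then show ?thesis by (rule field_le_epsilon)
qed

text \<open>Separation by projection: let c be the projection of -p, with p = v^-, onto the tangent
  cone. The residual r = p + c is nonnegative on the cone and orthogonal to c. As the cone contains
  V_plus and both z and -z, r is a positive functional vanishing at z, so r \<bullet> p \<le> 0; but
  r \<bullet> r = r \<bullet> p. Hence -p is tangent, and so is v = v^+ - p.\<close>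

lemma in_closure_radial_cone:
  assumes z: "z \<in> V_plus \<xi> \<iota>"
    and zq: "quasi_continuous \<xi> \<iota> zq" "AE x in \<xi>. zq x = \<iota> z x" "\<And>x. zq x \<ge> 0"
    and qe: "quasi_everywhere \<xi> \<iota> (\<lambda>x. zq x = 0 \<longrightarrow> qc_rep \<xi> \<iota> v x \<ge> 0)"
  shows "v \<in> closure (radial_cone z)"
proof -
  define T where "T = closure (radial_cone z)"
  define p where "p = pos_part \<xi> \<iota> (- v)"
  have "cone (radial_cone z)"
    unfolding cone_def
  proof (intro ballI allI impI)
    fix w and c :: real assume "w \<in> radial_cone z" "0 \<le> c"
    then obtain t where t: "t > 0" "z + t *\<^sub>R w \<in> V_plus \<xi> \<iota>" by (auto simp: radial_cone_def)
    show "c *\<^sub>R w \<in> radial_cone z"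
    proof (cases "c = 0")
      case True
      then show ?thesis using V_plus_subset_radial_cone[OF z] zero_in_V_plus by auto
    next
      case False
      with \<open>0 \<le> c\<close> t show ?thesis by (auto simp: radial_cone_def intro!: exI[of _ "t / c"])
    qed
  qed
  then have coneT: "cone T" unfolding T_def by (rule cone_closure)
  have T: "convex T" "closed T"
    using convex_radial_cone[OF z] by (auto simp: T_def convex_closure)
  have V_T: "V_plus \<xi> \<iota> \<subseteq> T"
    using V_plus_subset_radial_cone[OF z] closure_subset unfolding T_def by blast
  have "- z \<in> radial_cone z"
    using zero_in_V_plus by (auto simp: radial_cone_def intro!: exI[of _ 1])
  then have mz: "- z \<in> T" using closure_subset unfolding T_def by blast
  have "T \<noteq> {}" using mz by blast
  from closest_point_exists[OF T this, of "- p"]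
  obtain c where c: "c \<in> T" "\<And>t. t \<in> T \<Longrightarrow> (- p - c) \<bullet> (t - c) \<le> 0" by blast
  define r where "r = p + c"
  have ge: "r \<bullet> t \<ge> r \<bullet> c" if "t \<in> T" for t
    using c(2)[OF that] by (simp add: r_def inner_diff inner_add)
  have "0 \<in> T" "2 *\<^sub>R c \<in> T" using mem_cone[OF coneT c(1), of 0] mem_cone[OF coneT c(1), of 2] by auto
  then have rc: "r \<bullet> c = 0" using ge[of 0] ge[of "2 *\<^sub>R c"] by simp
  have "blinfun_apply (blinfun_inner_right r) p \<le> 0"
  proof (rule positive_functional_bound[OF z _ _ zq, where pq = "\<lambda>x. - min (qc_rep \<xi> \<iota> v x) 0"])
    show "blinfun_apply (blinfun_inner_right r) w \<ge> 0" if "w \<in> V_plus \<xi> \<iota>" for w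
      using ge[of w] V_T that rc by auto
    show "blinfun_apply (blinfun_inner_right r) z = 0"
      using ge[of z] ge[of "- z"] V_T z mz rc by auto
    show "quasi_continuous \<xi> \<iota> (\<lambda>x. - min (qc_rep \<xi> \<iota> v x) 0)"
      unfolding quasi_continuous_iff
    proof (intro allI impI)
      fix e :: real assume "e > 0"
      then obtain U y where "small_open e U y" and cont: "continuous_on (- U) (qc_rep \<xi> \<iota> v)"
        using qc_rep_quasi_continuous[of v] unfolding quasi_continuous_iff by blast
      moreover have "continuous_on (- U) (\<lambda>x. - min (qc_rep \<xi> \<iota> v x) 0)"
        by (intro continuous_intros cont)
      ultimately show "\<exists>U y. small_open e U y \<and> continuous_on (- U) (\<lambda>x. - min (qc_rep \<xi> \<iota> v x) 0)"
        by blast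
    qed
    show "AE x in \<xi>. - min (qc_rep \<xi> \<iota> v x) 0 = \<iota> p x"
      using qc_rep_AE[of v] incl_pos_part[of "- v"] incl_minus[of v]
      unfolding p_def by eventually_elim auto
    show "quasi_everywhere \<xi> \<iota> (\<lambda>x. zq x = 0 \<longrightarrow> - min (qc_rep \<xi> \<iota> v x) 0 \<le> 0)"
      using qe unfolding quasi_everywhere_def by fastforce
  qed
  moreover have "r \<bullet> r = r \<bullet> p" using rc unfolding r_def by (simp add: inner_add)
  ultimately have "r \<bullet> r \<le> 0" by simp
  then have "r = 0" using inner_gt_zero_iff[of r] by linarith
  then have "- p \<in> T" using c(1) by (simp add: r_def add_eq_0_iff)
  then have "2 *\<^sub>R (- p) \<in> T" by (intro mem_cone[OF coneT]) auto
  moreover have "2 *\<^sub>R pos_part \<xi> \<iota> v \<in> T"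
    using V_T pos_part_in_V_plus by (intro mem_cone[OF coneT]) auto
  ultimately have "(1/2) *\<^sub>R (2 *\<^sub>R pos_part \<xi> \<iota> v) + (1/2) *\<^sub>R (2 *\<^sub>R (- p)) \<in> T"
    by (intro convexD[OF T(1)]) auto
  then have "pos_part \<xi> \<iota> v - p \<in> T" by simp
  then show ?thesis using pos_part_minus_neg_part[of v] by (simp add: p_def T_def)
qed

end

section \<open>Boundedness of the iteration\<close>

lemma hadamard_derivative_tendsto:
  assumes "hadamard_differentiable F"
  shows "((\<lambda>(h', t). (F (v + t *\<^sub>R h') - F v) /\<^sub>R t) \<longlongrightarrow> hadamard_derivative F v h) (nhds h \<times>\<^sub>F at_right 0)"
proof -
  obtain l where l: "((\<lambda>(h', t). (F (v + t *\<^sub>R h') - F v) /\<^sub>R t) \<longlongrightarrow> l) (nhds h \<times>\<^sub>F at_right 0)"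
    using assms unfolding hadamard_differentiable_def by blast
  have "nhds h \<times>\<^sub>F at_right (0::real) \<noteq> bot" by (simp add: prod_filter_eq_bot)
  from tendsto_Lim[OF this l] l show ?thesis unfolding hadamard_derivative_def by simp
qed

text \<open>The joint limit at \<open>h = 0\<close> bounds the difference quotients near 0, and rescaling \<open>t\<close> carries
  the bound to every direction.\<close>

lemma hadamard_derivative_bounded:
  fixes F :: "'v::real_normed_vector \<Rightarrow> 'v"
  assumes "hadamard_differentiable F"
  shows "\<exists>L. \<forall>h. norm (hadamard_derivative F v h) \<le> L * (norm h + 1)"
proof -
  let ?q = "\<lambda>h' t. (F (v + t *\<^sub>R h') - F v) /\<^sub>R t"
  define B where "B = norm (hadamard_derivative F v 0) + 1"
  have "B > norm (hadamard_derivative F v 0)" by (simp add: B_def)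
  from order_tendstoD(2)[OF tendsto_norm[OF hadamard_derivative_tendsto[OF assms, of v 0]] this]
  have "eventually (\<lambda>(h', t). norm (?q h' t) < B) (nhds 0 \<times>\<^sub>F at_right 0)"
    by (simp add: case_prod_unfold)
  then obtain P Q where P: "eventually P (nhds 0)" and Q: "eventually Q (at_right 0)"
    and PQ: "\<And>h' t. P h' \<Longrightarrow> Q t \<Longrightarrow> norm (?q h' t) < B"
    unfolding eventually_prod_filter by auto
  obtain r where r: "r > 0" "\<And>h'. norm h' < r \<Longrightarrow> P h'"
    using P unfolding eventually_nhds_metric by (auto simp: dist_norm)
  obtain c where c: "c > 0" "\<And>t. 0 < t \<Longrightarrow> t < c \<Longrightarrow> Q t"
    using Q unfolding eventually_at_right_field by auto
  have "norm (hadamard_derivative F v h) \<le> B / r * (norm h + 1)" for h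
  proof -
    \<comment> \<open>This factor shrinks \<open>h\<close> into the ball of radius \<open>r\<close>
      where the quotients are bounded. The quotient at (s h, t/s) is s times the one at (h, t), so
      dividing by s gives the growth linear in norm h + 1.\<close>
    define s where "s = r / (norm h + 1)"
    have n: "norm h + 1 > 0" by (simp add: add_nonneg_pos)
    have s: "s > 0" using r n by (simp add: s_def)
    have "norm (s *\<^sub>R h) < r"
    proof -
      have "s * norm h < s * (norm h + 1)" using s by simp
      also have "\<dots> = r" using n by (simp add: s_def)
      finally show ?thesis using s by simp
    qed
    then have Ps: "P (s *\<^sub>R h)" by (rule r(2))
    have lim: "((\<lambda>t. ?q h t) \<longlongrightarrow> hadamard_derivative F v h) (at_right 0)"
    proof -
      have "filterlim (\<lambda>t. (h, t)) (nhds h \<times>\<^sub>F at_right 0) (at_right (0::real))"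
        by (intro filterlim_Pair tendsto_const filterlim_ident)
      from filterlim_compose[OF hadamard_derivative_tendsto[OF assms, of v h] this] show ?thesis by simp
    qed
    have "eventually (\<lambda>t. norm (?q h t) \<le> B / s) (at_right 0)"
    proof -
      have "norm (?q h t) \<le> B / s" if t: "0 < t" "t < c * s" for t
      proof -
        have "Q (t / s)" using t s by (intro c(2)) (auto simp: field_simps)
        from PQ[OF Ps this] have "norm (?q (s *\<^sub>R h) (t / s)) < B" .
        moreover have "?q (s *\<^sub>R h) (t / s) = s *\<^sub>R ?q h t"
        proof -
          have "(t / s) *\<^sub>R s *\<^sub>R h = t *\<^sub>R h" "inverse (t / s) = s * inverse t"
            using s by (simp_all add: divide_inverse)
          then show ?thesis by (simp only: scaleR_scaleR)
        qed
        ultimately have "norm (s *\<^sub>R ?q h t) < B" by (simp only:)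
        then show ?thesis using s unfolding norm_scaleR by (simp add: field_simps)
      qed
      moreover have "c * s > 0" using c s by simp
      ultimately show ?thesis unfolding eventually_at_right_field by blast
    qed
    from tendsto_upperbound[OF tendsto_norm[OF lim] this] show ?thesis by (simp add: s_def)
  qed
  then show ?thesis by blast
qed

context qvi_setting
begin

text \<open>The test functions are u - w and the obstacle \<Phi>(u) itself.\<close>

lemma Q_set_complementarity:
  assumes u: "u \<in> Q_set \<xi> \<iota> A \<Phi> f"
  shows "\<Phi> (\<iota> u) - u \<in> V_plus \<xi> \<iota>"
    and "w \<in> V_plus \<xi> \<iota> \<Longrightarrow> blinfun_apply (f - A u) w \<ge> 0"
    and "blinfun_apply (f - A u) (\<Phi> (\<iota> u) - u) = 0"
proof -
  have le: "AE x in \<xi>. \<iota> u x \<le> \<iota> (\<Phi> (\<iota> u)) x"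
    and vi: "\<And>v. AE x in \<xi>. \<iota> v x \<le> \<iota> (\<Phi> (\<iota> u)) x \<Longrightarrow> blinfun_apply (A u - f) (u - v) \<le> 0"
    using u by (auto simp: Q_set_def K_set_def)
  show z: "\<Phi> (\<iota> u) - u \<in> V_plus \<xi> \<iota>" using le by (simp add: V_plus_diff_iff)
  show nonneg: "blinfun_apply (f - A u) w \<ge> 0" if "w \<in> V_plus \<xi> \<iota>" for w
  proof -
    have "\<Phi> (\<iota> u) - (u - w) \<in> V_plus \<xi> \<iota>"
      using V_plus_add[OF z that] by (simp add: algebra_simps)
    then have "blinfun_apply (A u - f) (u - (u - w)) \<le> 0" unfolding V_plus_diff_iff by (rule vi)
    then show ?thesis by (simp add: blinfun.diff_left)
  qed
  have "blinfun_apply (A u - f) (u - \<Phi> (\<iota> u)) \<le> 0" by (rule vi) simp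
  with nonneg[OF z] show "blinfun_apply (f - A u) (\<Phi> (\<iota> u) - u) = 0"
    by (simp add: blinfun.diff_left blinfun.diff_right)
qed

text \<open>Off the coincidence set the density of f - Au vanishes a.e. by complementarity, and on
  it b vanishes a.e., so f - Au annihilates b. The q.e. sign gives tangency.\<close>

lemma in_critical_cone_if_vanishing_on_coincidence_set:
  assumes u: "u \<in> Q_set \<xi> \<iota> A \<Phi> f"
    and k: "represents \<xi> \<iota> k (A u)" and l: "represents \<xi> \<iota> l f"
    and compl: "AE x in \<xi>. (k x - l x) * (\<iota> u x - \<iota> (\<Phi> (\<iota> u)) x) = 0"
    and qe: "quasi_everywhere \<xi> \<iota> (\<lambda>x. x \<in> coincidence_set \<xi> \<iota> \<Phi> u \<longrightarrow> qc_rep \<xi> \<iota> b x \<ge> 0)"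
    and ae: "AE x in \<xi>. x \<in> coincidence_set \<xi> \<iota> \<Phi> u \<longrightarrow> qc_rep \<xi> \<iota> b x = 0"
  shows "b \<in> critical_cone (f - A u) (\<Phi> (\<iota> u) - u)"
proof (rule polyhedric_V_plus)
  let ?z = "\<Phi> (\<iota> u) - u"
  show z: "?z \<in> V_plus \<xi> \<iota>" by (rule Q_set_complementarity[OF u])
  show "b \<in> closure (radial_cone ?z)"
  proof (rule in_closure_radial_cone[OF z])
    \<comment> \<open>The absolute value provides a representative of z that is nonnegative at every
      point and whose zero set is exactly the coincidence set.\<close>
    show "quasi_continuous \<xi> \<iota> (\<lambda>x. \<bar>qc_rep \<xi> \<iota> u x - qc_rep \<xi> \<iota> (\<Phi> (\<iota> u)) x\<bar>)"
      by (intro quasi_continuous_abs_diff qc_rep_quasi_continuous)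
    have "AE x in \<xi>. \<iota> u x \<le> \<iota> (\<Phi> (\<iota> u)) x" using z unfolding V_plus_diff_iff .
    then show "AE x in \<xi>. \<bar>qc_rep \<xi> \<iota> u x - qc_rep \<xi> \<iota> (\<Phi> (\<iota> u)) x\<bar> = \<iota> ?z x"
      using qc_rep_AE[of u] qc_rep_AE[of "\<Phi> (\<iota> u)"] incl_diff[of "\<Phi> (\<iota> u)" u]
      by eventually_elim simp
    show "quasi_everywhere \<xi> \<iota> (\<lambda>x. \<bar>qc_rep \<xi> \<iota> u x - qc_rep \<xi> \<iota> (\<Phi> (\<iota> u)) x\<bar> = 0 \<longrightarrow> 0 \<le> qc_rep \<xi> \<iota> b x)"
      using qe by (simp add: coincidence_set_def)
  qed simp
  have [measurable]: "k \<in> borel_measurable \<xi>" "l \<in> borel_measurable \<xi>"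
    using k l by (auto simp: represents_def L2_def)
  have "AE x in \<xi>. l x * \<iota> b x = k x * \<iota> b x"
    using compl ae qc_rep_AE[of u] qc_rep_AE[of "\<Phi> (\<iota> u)"] qc_rep_AE[of b]
    by eventually_elim (auto simp: coincidence_set_def)
  then have "(\<integral>x. l x * \<iota> b x \<partial>\<xi>) = (\<integral>x. k x * \<iota> b x \<partial>\<xi>)" by (intro integral_cong_AE) auto
  then show "blinfun_apply (f - A u) b = 0"
    using k l by (simp add: represents_def blinfun.diff_left)
qed (use Q_set_complementarity[OF u] in auto)

section \<open>Norm bounds for the iterates\<close>

lemma coercive_norm_le:
  assumes "blinfun_apply (A a - d) a \<le> 0"
  shows "norm a \<le> norm d / C\<^sub>a"
proof -
  have "C\<^sub>a * (norm a)\<^sup>2 \<le> blinfun_apply d a"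
    using A_coercive[of a] assms by (simp add: blinfun.diff_left)
  also have "\<dots> \<le> norm d * norm a" using norm_blinfun[of d a] by simp
  finally have "C\<^sub>a * norm a \<le> norm d"
    by (cases "a = 0") (auto simp: power2_eq_square mult.assoc[symmetric])
  then show ?thesis using C\<^sub>a_pos by (simp add: field_simps)
qed

text \<open>If the norm of a exceeded M, it would exceed that of a', so b would be controlled by a
  itself. The pairing of Aa with b then uses up at most (\<open>C\<^sub>a\<close> - c) of the
  coercivity constant, and the remaining c absorbs the terms in d.\<close>

lemma contraction_step_norm_le:
  assumes step: "blinfun_apply (A a - d) (a - b) \<le> 0"
    and b: "norm b \<le> (C\<^sub>a - c) / C\<^sub>b * norm a'" and a': "norm a' \<le> M" and c: "c > 0"
    and M: "norm d * (1 + \<bar>(C\<^sub>a - c) / C\<^sub>b\<bar>) / c \<le> M" "norm d / C\<^sub>a \<le> M"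
  shows "norm a \<le> M"
\<comment> \<open>No sign of \<open>C\<^sub>b\<close> or of the quotient is assumed. Nonzero a'
  forces the quotient to be nonnegative, and nonzero a forces \<open>C\<^sub>b\<close> > 0; the
  degenerate cases are settled directly.\<close>
proof (cases "a = 0 \<or> a' = 0")
  case True
  then show ?thesis
  proof
    assume "a = 0"
    then show ?thesis using order_trans[OF norm_ge_zero a'] by simp
  next
    assume "a' = 0"
    then have "b = 0" using b by simp
    then have "norm a \<le> norm d / C\<^sub>a" using step by (intro coercive_norm_le) simp
    then show ?thesis using M(2) by simp
  qed
next
  case False
  define q where "q = (C\<^sub>a - c) / C\<^sub>b"
  have "0 \<le> q * norm a'" using b norm_ge_zero[of b] unfolding q_def by linarith
  then have q: "q \<ge> 0" using False by (simp add: zero_le_mult_iff)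
  have "C\<^sub>a * (norm a)\<^sup>2 \<le> C\<^sub>b * norm a * norm a"
    using A_coercive[of a] A_bounded[of a a] by linarith
  then have "C\<^sub>a * (norm a)\<^sup>2 \<le> C\<^sub>b * (norm a)\<^sup>2" by (simp add: power2_eq_square mult.assoc)
  then have C\<^sub>b: "C\<^sub>b > 0" using False C\<^sub>a_pos by simp
  show ?thesis
  proof (rule ccontr)
    assume "\<not> norm a \<le> M"
    then have "norm a' \<le> norm a" using a' by simp
    then have "q * norm a' \<le> q * norm a" using q by (rule mult_left_mono)
    then have b': "norm b \<le> q * norm a" using b unfolding q_def by linarith
    have "blinfun_apply (A a) b \<le> C\<^sub>b * norm a * norm b" by (rule A_bounded)
    also have "\<dots> \<le> C\<^sub>b * norm a * (q * norm a)" using b' C\<^sub>b by (intro mult_left_mono) auto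
    also have "\<dots> = (C\<^sub>a - c) * (norm a)\<^sup>2" using C\<^sub>b by (simp add: q_def power2_eq_square)
    finally have Ab: "blinfun_apply (A a) b \<le> (C\<^sub>a - c) * (norm a)\<^sup>2" .
    have "blinfun_apply d (a - b) \<le> norm d * norm (a - b)" using norm_blinfun[of d "a - b"] by simp
    also have "\<dots> \<le> norm d * (norm a + q * norm a)"
      using norm_triangle_ineq4[of a b] b' by (intro mult_left_mono) auto
    finally have d: "blinfun_apply d (a - b) \<le> norm d * (1 + q) * norm a" by (simp add: algebra_simps)
    have "C\<^sub>a * (norm a)\<^sup>2 \<le> blinfun_apply (A a) b + blinfun_apply d (a - b)"
      using A_coercive[of a] step by (simp add: blinfun.diff_left blinfun.diff_right)
    also have "\<dots> \<le> (C\<^sub>a - c) * (norm a)\<^sup>2 + norm d * (1 + q) * norm a" using Ab d by (rule add_mono)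
    finally have "c * norm a * norm a \<le> norm d * (1 + q) * norm a"
      by (simp add: algebra_simps power2_eq_square)
    then have "c * norm a \<le> norm d * (1 + q)" using False by simp
    then have "norm a \<le> norm d * (1 + q) / c" using c by (simp add: field_simps)
    also have "\<dots> \<le> M" using M(1)[folded q_def] q by simp
    finally show False using \<open>\<not> norm a \<le> M\<close> by simp
  qed
qed

end

theorem theorem5p2:
  fixes \<xi> :: "'a::t2_space measure"
    and \<iota> :: "'v::{real_inner, complete_space} \<Rightarrow> 'a \<Rightarrow> real"
    and \<kappa> C\<^sub>a C\<^sub>b :: real
    and A :: "'v \<Rightarrow> ('v \<Rightarrow>\<^sub>L real)"
    and \<Phi> :: "('a \<Rightarrow> real) \<Rightarrow> 'v"
    and f d :: "'v \<Rightarrow>\<^sub>L real"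
    and u ubar :: 'v
    and \<alpha> \<delta> :: "nat \<Rightarrow> 'v"
  assumes "qvi_setting \<xi> \<iota> \<kappa> A C\<^sub>a C\<^sub>b \<Phi>"
    and "hadamard_differentiable (\<lambda>v. \<Phi> (\<iota> v))"
    and "f \<in> Vstar_plus \<xi> \<iota>" and "d \<in> Vstar_plus \<xi> \<iota>"
    and "A ubar = f"
    and "u \<in> Q_set \<xi> \<iota> A \<Phi> f"
    and "AE x in \<xi>. 0 \<le> \<iota> u x \<and> \<iota> u x \<le> \<iota> ubar x"
    and "\<alpha> 1 = dS \<xi> \<iota> A \<Phi> f u d" and "\<delta> 1 = dS \<xi> \<iota> A \<Phi> f u d"
    and "\<And>n. n \<ge> 2 \<Longrightarrow> \<delta> n = dS \<xi> \<iota> A \<Phi> f u (d - A (D\<Phi> \<iota> \<Phi> u (\<alpha> (n - 1))))"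
    and "\<And>n. n \<ge> 2 \<Longrightarrow> \<alpha> n = D\<Phi> \<iota> \<Phi> u (\<alpha> (n - 1)) + \<delta> n"
    and "((\<exists>k l. represents \<xi> \<iota> k (A u) \<and> represents \<xi> \<iota> l f \<and>
              (AE x in \<xi>. (k x - l x) * (\<iota> u x - \<iota> (\<Phi> (\<iota> u)) x) = 0)) \<and>
          (\<forall>n\<ge>1. quasi_everywhere \<xi> \<iota>
                (\<lambda>x. x \<in> coincidence_set \<xi> \<iota> \<Phi> u \<longrightarrow> qc_rep \<xi> \<iota> (D\<Phi> \<iota> \<Phi> u (\<alpha> n)) x \<ge> 0) \<and>
              (AE x in \<xi>. x \<in> coincidence_set \<xi> \<iota> \<Phi> u \<longrightarrow> qc_rep \<xi> \<iota> (D\<Phi> \<iota> \<Phi> u (\<alpha> n)) x = 0)))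
        \<or> (\<exists>c>0. \<forall>b. norm (D\<Phi> \<iota> \<Phi> u b) \<le> (C\<^sub>a - c) / C\<^sub>b * norm b)"
  shows "bounded (\<alpha> ` {1..}) \<and> bounded (\<delta> ` {1..})"
proof -
  interpret qvi_setting \<xi> \<iota> \<kappa> A C\<^sub>a C\<^sub>b \<Phi> by (rule assms(1))
  note u = assms(6) and \<alpha>1 = assms(8) and \<delta>1 = assms(9) and \<delta> = assms(10) and \<alpha> = assms(11)
  let ?D = "D\<Phi> \<iota> \<Phi> u"
  let ?C = "critical_cone (f - A u) (\<Phi> (\<iota> u) - u)"
  have zero: "0 \<in> ?C" by (rule zero_in_critical_cone[OF Q_set_complementarity(1)[OF u]])
  have first: "norm (\<alpha> 1) \<le> norm d / C\<^sub>a"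
    using dS_variational_inequality[OF u zero, of d] unfolding \<alpha>1[symmetric] by (intro coercive_norm_le) simp
  have vi: "blinfun_apply (A (\<alpha> n) - d) (\<alpha> n - ?D (\<alpha> (n - 1)) + v) \<le> 0" if "n \<ge> 2" "v \<in> ?C" for n v
  proof -
    have "\<delta> n = \<alpha> n - ?D (\<alpha> (n - 1))" using \<alpha>[OF that(1)] by simp
    then show ?thesis
      using dS_variational_inequality[OF u that(2), of "d - A (?D (\<alpha> (n - 1)))"]
      unfolding \<delta>[OF that(1), symmetric] by (simp add: linear_diff[OF A_linear])
  qed
  have "\<exists>M. \<forall>n\<ge>1. norm (\<alpha> n) \<le> M"
    using assms(12)
  proof (elim disjE exE conjE)
    fix k l
    assume k: "represents \<xi> \<iota> k (A u)" "represents \<xi> \<iota> l f"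
      "AE x in \<xi>. (k x - l x) * (\<iota> u x - \<iota> (\<Phi> (\<iota> u)) x) = 0"
      and b: "\<forall>n\<ge>1. quasi_everywhere \<xi> \<iota>
                (\<lambda>x. x \<in> coincidence_set \<xi> \<iota> \<Phi> u \<longrightarrow> qc_rep \<xi> \<iota> (?D (\<alpha> n)) x \<ge> 0) \<and>
              (AE x in \<xi>. x \<in> coincidence_set \<xi> \<iota> \<Phi> u \<longrightarrow> qc_rep \<xi> \<iota> (?D (\<alpha> n)) x = 0)"
    have "norm (\<alpha> n) \<le> norm d / C\<^sub>a" if n: "n \<ge> 1" for n
    proof (cases "n = 1")
      case False
      then have n2: "n \<ge> 2" and n1: "n - 1 \<ge> 1" using n by auto
      have "?D (\<alpha> (n - 1)) \<in> ?C"
        using b[rule_format, OF n1]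
        by (intro in_critical_cone_if_vanishing_on_coincidence_set[OF u k]) auto
      from vi[OF n2 this] show ?thesis by (intro coercive_norm_le) simp
    qed (use first in simp)
    then show ?thesis by blast
  next
    fix c :: real
    assume c: "c > 0" "\<forall>b. norm (?D b) \<le> (C\<^sub>a - c) / C\<^sub>b * norm b"
    \<comment> \<open>The first entry closes the induction step; the second covers \<alpha>_1 and a
      vanishing predecessor.\<close>
    define M where "M = max (norm d * (1 + \<bar>(C\<^sub>a - c) / C\<^sub>b\<bar>) / c) (norm d / C\<^sub>a)"
    have "norm (\<alpha> n) \<le> M" if "n \<ge> 1" for n
      using that
    proof (induction n rule: dec_induct)
      case base
      show ?case using first by (simp add: M_def)
    next
      case (step n)
      have "blinfun_apply (A (\<alpha> (Suc n)) - d) (\<alpha> (Suc n) - ?D (\<alpha> n)) \<le> 0"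
        using vi[of "Suc n" 0] zero step.hyps by simp
      then show ?case
        by (rule contraction_step_norm_le[OF _ c(2)[rule_format] step.IH c(1)]) (simp_all add: M_def)
    qed
    then show ?thesis by blast
  qed
  then obtain M where M: "\<And>n. n \<ge> 1 \<Longrightarrow> norm (\<alpha> n) \<le> M" by blast
  obtain L where L: "\<And>h. norm (?D h) \<le> L * (norm h + 1)"
    using hadamard_derivative_bounded[OF assms(2), of u] unfolding D\<Phi>_def by blast
  have "norm (\<delta> n) \<le> M + \<bar>L\<bar> * (M + 1)" if n: "n \<ge> 1" for n
  proof (cases "n = 1")
    case True
    have "norm (\<alpha> 1) \<le> M" by (rule M) simp
    moreover from this have "0 \<le> \<bar>L\<bar> * (M + 1)"
      using norm_ge_zero[of "\<alpha> 1"] by (intro mult_nonneg_nonneg) linarith+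
    ultimately show ?thesis using True \<alpha>1 \<delta>1 by simp
  next
    case False
    then have n2: "n \<ge> 2" and n1: "n - 1 \<ge> 1" using n by auto
    have "norm (\<delta> n) \<le> norm (\<alpha> n) + norm (?D (\<alpha> (n - 1)))"
      using norm_triangle_ineq4[of "\<alpha> n" "?D (\<alpha> (n - 1))"] \<alpha>[OF n2] by simp
    also have "norm (?D (\<alpha> (n - 1))) \<le> \<bar>L\<bar> * (M + 1)"
      using L[of "\<alpha> (n - 1)"] M[OF n1]
      by (elim order_trans) (intro mult_mono, auto simp: add_nonneg_nonneg)
    finally show ?thesis using M[OF n] by simp
  qed
  with M show ?thesis by (auto simp: bounded_iff)
qed

end
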